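(* Let $k,n\in\mathbb N$ with $1\le k<n$, let $\lambda\vdash n$ and $x\in\lambda$. Then $$(n-k)\,\Delta_\lambda(k,x)=(n-1)!-\frac{n!\,f_\lambda(k,x)}{f_\lambda}+\sum_{l=1}^{k-1}\Delta_\lambda(l,x),$$ and consequently $$\Delta_\lambda(k,x)=\frac{n!}{(n-k)(n-k+1)}\left(1-\frac{f_\lambda(k,x)}{f_\lambda}(n-k+1)-\sum_{l=1}^{k-1}\frac{f_\lambda(l,x)}{f_\lambda}\right).$$
   Context: A partition $\lambda\vdash n$ is identified with its Young diagram $\{(i,j): i\ge1,\ 1\le j\le\lambda_i\}$. A tabloid is a bijection $T:\lambda\to\{1,\dots,n\}$; $\operatorname{T}(\lambda)$ is the set of tabloids. A standard Young tableau is a tabloid whose entries increase along rows and down columns; $f_\lambda$ is the number of standard Young tableaux of shape $\lambda$ and $f_\lambda(k,x)$ the number of those with entry $k$ in cell $x$. $N^-_\lambda(x)$ denotes the set of top and left neighbours $\{(i-1,j),(i,j-1)\}\cap\lambda$ of $x=(i,j)$, and $N^+_\lambda(x)=\{(i,j+1),(i+1,j)\}\cap\lambda$ the right and bottom neighbours. Order cells by $(i,j)\prec(k,l)$ iff $j<l$, or $j=l$ and $i<k$; list them $z_1\prec\dots\prec z_n$. Novelli--Pak--Stoyanovskii sorting of $T$: $T_{z_n}:=T$; for $m=n-1,\dots,1$, $T_{z_m}$ is obtained from $T_{z_{m+1}}$ by the slide at $z_m$: the entry in $z_m$ is repeatedly exchanged with the smaller of the entries in its current right and bottom neighbours as long as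 that entry is smaller than it. Local exchange numbers: for $1\le k<n$ and cells $x,y$, $\varepsilon_\lambda(k,x,y)$ is the number of $T\in\operatorname{T}(\lambda)$ such that for some $m$, $T(z_m)=n$, $T_{z_{m+1}}(x)=k$ and $T_{z_m}(y)=k$ (i.e. the slide of the entry $n$ moves $k$ from $x$ to $y$). Signed exit numbers: $\Delta_\lambda(k,x):=\sum_{y\in N^-_\lambda(x)}\varepsilon_\lambda(k,x,y)-\sum_{y\in N^+_\lambda(x)}\varepsilon_\lambda(k,y,x)$. *)

theory Defs
  imports Complex_Main "HOL-Library.Product_Lexorder"
begin

type_synonym cell = "nat \<times> nat"
type_synonym tabl = "cell \<Rightarrow> nat"

definition is_partition :: "nat list \<Rightarrow> nat \<Rightarrow> bool" where
  "is_partition lam n \<longleftrightarrow> sorted (rev lam) \<and> (\<forall>p\<in>set lam. 0 < p) \<and> sum_list lam = n"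

definition diagram :: "nat list \<Rightarrow> cell set" where
  "diagram lam = {(i, j). 1 \<le> i \<and> i \<le> length lam \<and> 1 \<le> j \<and> j \<le> lam ! (i - 1)}"

definition tabloids :: "nat list \<Rightarrow> tabl set" where
  "tabloids lam = {T. bij_betw T (diagram lam) {1..sum_list lam} \<and> (\<forall>c. c \<notin> diagram lam \<longrightarrow> T c = 0)}"

definition standard :: "nat list \<Rightarrow> tabl \<Rightarrow> bool" where
  "standard lam T \<longleftrightarrow> T \<in> tabloids lam \<and>
     (\<forall>i j. (i, j) \<in> diagram lam \<and> (i, Suc j) \<in> diagram lam \<longrightarrow> T (i, j) < T (i, Suc j)) \<and>
     (\<forall>i j. (i, j) \<in> diagram lam \<and> (Suc i, j) \<in> diagram lam \<longrightarrow> T (i, j) < T (Suc i, j))"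

definition f_lam :: "nat list \<Rightarrow> nat" where
  "f_lam lam = card {T. standard lam T}"

definition f_lam_at :: "nat list \<Rightarrow> nat \<Rightarrow> cell \<Rightarrow> nat" where
  "f_lam_at lam k x = card {T. standard lam T \<and> T x = k}"

definition N_minus :: "nat list \<Rightarrow> cell \<Rightarrow> cell set" where
  "N_minus lam x = {(fst x - 1, snd x), (fst x, snd x - 1)} \<inter> diagram lam"

definition N_plus :: "nat list \<Rightarrow> cell \<Rightarrow> cell set" where
  "N_plus lam x = {(fst x, Suc (snd x)), (Suc (fst x), snd x)} \<inter> diagram lam"

text \<open>Cells listed in the order (i,j) < (k,l) iff j<l, or j=l and i<k; z lam m is z_m (1-indexed).\<close>
definition cell_list :: "nat list \<Rightarrow> cell list" where
  "cell_list lam = map (\<lambda>(j, i). (i, j)) (sorted_list_of_set ((\<lambda>(i, j). (j, i)) ` diagram lam))"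

definition z :: "nat list \<Rightarrow> nat \<Rightarrow> cell" where
  "z lam m = cell_list lam ! (m - 1)"

definition swap_cells :: "tabl \<Rightarrow> cell \<Rightarrow> cell \<Rightarrow> tabl" where
  "swap_cells T a b = T(a := T b, b := T a)"

text \<open>One slide at a cell; the fuel argument bounds the number of exchanges
  (fuel = number of cells always suffices).\<close>
fun slide_fuel :: "cell set \<Rightarrow> tabl \<Rightarrow> cell \<Rightarrow> nat \<Rightarrow> tabl" where
  "slide_fuel D T c 0 = T"
| "slide_fuel D T (i, j) (Suc f) =
     (let r = (i, Suc j); b = (Suc i, j) in
      if r \<in> D \<or> b \<in> D then
        (let y = (if r \<in> D \<and> b \<in> D then (if T r < T b then r else b)
                  else if r \<in> D then r else b) in
         if T y < T (i, j) then slide_fuel D (swap_cells T (i, j) y) y f else T)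
      else T)"

definition slide :: "nat list \<Rightarrow> tabl \<Rightarrow> cell \<Rightarrow> tabl" where
  "slide lam T c = slide_fuel (diagram lam) T c (sum_list lam)"

text \<open>nps_seq lam T t = tabloid after t slides, i.e. T_{z_(n-t)}.\<close>
fun nps_seq :: "nat list \<Rightarrow> tabl \<Rightarrow> nat \<Rightarrow> tabl" where
  "nps_seq lam T 0 = T"
| "nps_seq lam T (Suc t) = slide lam (nps_seq lam T t) (z lam (sum_list lam - Suc t))"

definition Tz :: "nat list \<Rightarrow> tabl \<Rightarrow> nat \<Rightarrow> tabl" where
  "Tz lam T m = nps_seq lam T (sum_list lam - m)"

definition eps :: "nat list \<Rightarrow> nat \<Rightarrow> cell \<Rightarrow> cell \<Rightarrow> nat" where
  "eps lam k x y = card {T \<in> tabloids lam. \<exists>m. 1 \<le> m \<and> m < sum_list lam \<and>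
      T (z lam m) = sum_list lam \<and> Tz lam T (Suc m) x = k \<and> Tz lam T m y = k}"

definition Delta :: "nat list \<Rightarrow> nat \<Rightarrow> cell \<Rightarrow> int" where
  "Delta lam k x = (\<Sum>y\<in>N_minus lam x. int (eps lam k x y)) - (\<Sum>y\<in>N_plus lam x. int (eps lam k y x))"

end

theory Submission
  imports Defs "HOL-Library.FuncSet" "HOL-Combinatorics.Permutations"
begin

text \<open>
  For \<open>l < v\<close>, interchanging the entries \<open>v\<close> and \<open>v + 1\<close> of a tabloid turns the slide of \<open>v\<close> into the
  slide of \<open>v + 1\<close> without changing how \<open>l\<close> is moved, so the signed exit numbers of \<open>l\<close> with respect to the slides
  of any \<open>v > l\<close> agree with those for \<open>v = n\<close>. Every slide keeps the cell \<open>x\<close> occupied, so the net exits from \<open>x\<close>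
  of \<open>k\<close> during its own slides are minus the sum of the net exits of all \<open>l < k\<close>. Adding up the net exits of \<open>k\<close>
  over all slides compares its initial distribution with its final one, which is that of a uniformly random
  standard Young tableau by the theorem of Novelli, Pak and Stoyanovskii.

  That theorem is proved by undoing one slide at a time. A tableau sorted from the cell \<open>(i, j)\<close> on may arise from
  several slides at \<open>(i, j)\<close>, one for each end cell whose backward path leads to \<open>(i, j)\<close>; the hook functions on
  the cells \<open>(i, j), \<dots>, (h, j)\<close> all of whose candidate cells have this property count the possible histories.
\<close>

section \<open>Slides\<close>

text \<open>The factor \<open>n - k\<close> counts the values \<open>v > k\<close>, each of which
  contributes one copy of the exit number of \<open>k\<close>; values \<open>v < k\<close>
  contribute nothing, because a slide displaces smaller entries only. The constant relating tabloids
  to standard tableaux is found by counting all tabloids, so no hook length has to be multiplied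
  out. The obstacle is uniformity. Inside a column, the number of tabloids that are sorted to a
  given partial tableau may depend on that tableau, so an induction over the slides has to carry a
  count that depends on it as well. This count becomes constant only when a column is finished: from
  row 1 no backward path can escape to the north, and every hook function qualifies. The count is
  consistent from slide to slide because backward paths do not cross. This singles out one outermost
  candidate as the end of the last slide, and it reduces the question which cells are candidates
  before that slide to a comparison with its path.\<close>

definition cle :: "cell \<Rightarrow> cell \<Rightarrow> bool" where
  "cle u w \<longleftrightarrow> fst u \<le> fst w \<and> snd u \<le> snd w"

text \<open>All comparable pairs are compared, not only adjacent ones, so that removing a cell from
  \<open>A\<close> keeps the comparisons across it.\<close>

definition incr_on :: "cell set \<Rightarrow> tabl \<Rightarrow> bool" where
  "incr_on A V \<longleftrightarrow> (\<forall>u\<in>A. \<forall>w\<in>A. cle u w \<longrightarrow> u \<noteq> w \<longrightarrow> V u < V w)"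

definition nbrs :: "cell \<Rightarrow> cell set" where
  "nbrs q = {(fst q, Suc (snd q)), (Suc (fst q), snd q)}"

definition exch :: "cell set \<Rightarrow> tabl \<Rightarrow> cell \<Rightarrow> cell \<Rightarrow> bool" where
  "exch D V q y \<longleftrightarrow> y \<in> D \<inter> nbrs q \<and> (\<forall>w\<in>D \<inter> nbrs q. V y \<le> V w) \<and> V y < V q"

text \<open>A run may stop after any exchange; that it has come to its end is stated separately
  where it matters. Such partial runs can be undone exchange by exchange, without any fuel.\<close>

inductive slides :: "cell set \<Rightarrow> tabl \<Rightarrow> cell \<Rightarrow> tabl \<Rightarrow> cell \<Rightarrow> bool" for D where
  refl: "slides D V q V q"
| step: "exch D V q y \<Longrightarrow> slides D (swap_cells V q y) y W x \<Longrightarrow> slides D V q W x"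

lemma cle_refl [simp]: "cle u u" by (simp add: cle_def)

lemma cle_trans: "cle u v \<Longrightarrow> cle v w \<Longrightarrow> cle u w"
  by (auto simp: cle_def)

lemma cle_antisym: "cle u v \<Longrightarrow> cle v u \<Longrightarrow> u = v"
  by (auto simp: cle_def prod_eq_iff)

lemma cle_nbrs: "y \<in> nbrs q \<Longrightarrow> cle q y" "y \<in> nbrs q \<Longrightarrow> y \<noteq> q" "y \<in> nbrs q \<Longrightarrow> \<not> cle y q"
  by (cases y; cases q; auto simp: cle_def nbrs_def)+

lemma swap_cells_simps [simp]:
  "swap_cells V a b b = V a" "swap_cells V a b a = V b"
  "u \<noteq> a \<Longrightarrow> u \<noteq> b \<Longrightarrow> swap_cells V a b u = V u"
  by (auto simp: swap_cells_def)

lemma swap_cells_swap [simp]: "swap_cells (swap_cells V a b) a b = V"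
  by (auto simp: swap_cells_def fun_eq_iff)

lemma inj_on_swap_cells:
  assumes "inj_on V D" "a \<in> D" "b \<in> D"
  shows "inj_on (swap_cells V a b) D"
  using assms by (auto simp: swap_cells_def inj_on_def)

lemma image_swap_cells:
  assumes "a \<in> A" "b \<in> A"
  shows "swap_cells V a b ` A = V ` A"
  using assms by (auto simp: swap_cells_def image_iff)

lemma slide_fuel_Suc_cases:
  obtains (step) y where "exch D V q y" "slide_fuel D V q (Suc f) = slide_fuel D (swap_cells V q y) y f"
  | (stop) "\<And>w. w \<in> D \<inter> nbrs q \<Longrightarrow> V q \<le> V w" "slide_fuel D V q (Suc f) = V"
proof -
  obtain i j where q: "q = (i, j)" by (cases q)
  define r where "r = (i, Suc j)"
  define b where "b = (Suc i, j)"
  have nb: "nbrs q = {r, b}" by (simp add: nbrs_def q r_def b_def)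
  define y where "y = (if r \<in> D \<and> b \<in> D then (if V r < V b then r else b)
                  else if r \<in> D then r else b)"
  have eq: "slide_fuel D V q (Suc f) = (if (r \<in> D \<or> b \<in> D) \<and> V y < V q
     then slide_fuel D (swap_cells V q y) y f else V)"
    by (simp add: q r_def b_def y_def Let_def)
  have y: "r \<in> D \<or> b \<in> D \<Longrightarrow> y \<in> D \<inter> nbrs q \<and> (\<forall>w\<in>D \<inter> nbrs q. V y \<le> V w)"
    by (auto simp: nb y_def)
  show thesis
  proof (cases "(r \<in> D \<or> b \<in> D) \<and> V y < V q")
    case True
    then show thesis using step[of y] y eq by (auto simp: exch_def)
  next
    case False
    have "V q \<le> V w" if "w \<in> D \<inter> nbrs q" for w
    proof -
      have "r \<in> D \<or> b \<in> D" using that nb by auto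
      with False y that show ?thesis by force
    qed
    with False show thesis using stop eq by auto
  qed
qed

text \<open>Each exchange strictly shrinks the set of cells weakly southeast of the moving entry, so
  the size of this set is enough fuel.\<close>

lemma slide_fuel_slides:
  assumes "finite D" "q \<in> D" "card {u \<in> D. cle q u} \<le> f"
  shows "\<exists>x. slides D V q (slide_fuel D V q f) x \<and>
     (\<forall>w\<in>D \<inter> nbrs x. slide_fuel D V q f x \<le> slide_fuel D V q f w)"
  using assms
proof (induction f arbitrary: V q)
  case 0
  then have "{u \<in> D. cle q u} = {}" by simp
  then show ?case using 0 cle_refl by blast
next
  case (Suc f)
  show ?case
  proof (cases rule: slide_fuel_Suc_cases[of D V q f])
    case (step y)
    have y: "y \<in> D" "cle q y" "\<not> cle y q" using step(1) cle_nbrs by (auto simp: exch_def)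
    have "{u \<in> D. cle y u} \<subset> {u \<in> D. cle q u}"
      using y Suc.prems(2) cle_trans[OF y(2)] by (auto intro!: psubsetI)
    then have "card {u \<in> D. cle y u} < card {u \<in> D. cle q u}"
      using Suc.prems(1) by (intro psubset_card_mono) auto
    then have "card {u \<in> D. cle y u} \<le> f" using Suc.prems by linarith
    from Suc.IH[OF Suc.prems(1) y(1) this, of "swap_cells V q y"] step
    show ?thesis by (auto intro: slides.step)
  next
    case stop
    then show ?thesis using slides.refl[of D V q] by (intro exI[of _ q]) auto
  qed
qed

lemma slide_fuel_unaffected:
  "\<not> cle q u \<Longrightarrow> slide_fuel D V q f u = V u"
proof (induction f arbitrary: V q)
  case (Suc f)
  show ?case
  proof (cases rule: slide_fuel_Suc_cases[of D V q f])
    case (step y)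
    have y: "cle q y" using step(1) cle_nbrs by (auto simp: exch_def)
    then have "\<not> cle y u" using Suc.prems cle_trans by blast
    moreover have "u \<noteq> q" "u \<noteq> y" using Suc.prems y by auto
    ultimately show ?thesis using Suc.IH[of y "swap_cells V q y"] step by simp
  next
    case stop
    then show ?thesis by simp
  qed
qed simp

lemma slide_fuel_large:
  "V q < V u \<Longrightarrow> slide_fuel D V q f u = V u"
proof (induction f arbitrary: V q)
  case (Suc f)
  show ?case
  proof (cases rule: slide_fuel_Suc_cases[of D V q f])
    case (step y)
    have "u \<noteq> q" "u \<noteq> y" using step Suc.prems by (auto simp: exch_def)
    then show ?thesis using Suc.IH[of "swap_cells V q y" y] step Suc.prems by simp
  next
    case stop
    then show ?thesis by simp
  qed
qed simp

text \<open>The moving entry never returns to a cell, so each entry that it passes is displaced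
  once, by one cell to the left or upwards. Hence exchanges between neighbours account for all moves
  of \<open>k\<close>.\<close>

lemma slide_fuel_local:
  "slide_fuel D V q f u \<in> {V u, V q} \<union> V ` (D \<inter> nbrs u)"
proof (induction f arbitrary: V q)
  case (Suc f)
  show ?case
  proof (cases rule: slide_fuel_Suc_cases[of D V q f])
    case (step y)
    have y: "y \<in> D" "y \<in> nbrs q" using step(1) by (auto simp: exch_def)
    let ?V = "swap_cells V q y"
    show ?thesis
    proof (cases "cle y u")
      case False
      then have "slide_fuel D V q (Suc f) u = ?V u" using step slide_fuel_unaffected by simp
      moreover have "?V u = V u \<or> (u = q \<and> ?V u = V y)"
        using False by (auto simp: swap_cells_def)
      ultimately show ?thesis using y by auto
    next
      case True
      then have u: "u \<noteq> q" "q \<notin> nbrs u"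
        using y cle_nbrs cle_trans cle_antisym by blast+
      have "?V u \<in> {V u, V q}" using u by (auto simp: swap_cells_def)
      moreover have "?V ` (D \<inter> nbrs u) \<subseteq> {V q} \<union> V ` (D \<inter> nbrs u)"
        using u by (auto simp: swap_cells_def)
      ultimately show ?thesis using Suc.IH[of ?V y] step by auto
    qed
  next
    case stop
    then show ?thesis by simp
  qed
qed simp

text \<open>A slide compares only entries weakly southeast of \<open>q\<close>, so \<open>g\<close>
  has to be monotone on those alone. A transposition of \<open>v\<close> and \<open>v + 1\<close>
  is, as soon as one of the two is absent there.\<close>

lemma slide_fuel_comp:
  assumes "q \<in> D" "strict_mono_on (V ` {u \<in> D. cle q u}) g"
  shows "slide_fuel D (\<lambda>u. g (V u)) q f = (\<lambda>u. g (slide_fuel D V q f u))"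
  using assms
proof (induction f arbitrary: V q)
  case (Suc f)
  obtain i j where q: "q = (i, j)" by (cases q)
  have lt: "g (V u) < g (V w) \<longleftrightarrow> V u < V w" if "u \<in> D" "w \<in> D" "cle q u" "cle q w" for u w
    using strict_mono_on_less[OF Suc.prems(2), of "V u" "V w"] that by auto
  have sw: "swap_cells (\<lambda>u. g (V u)) a b = (\<lambda>u. g (swap_cells V a b u))" for a b
    by (auto simp: swap_cells_def fun_eq_iff)
  have IH: "slide_fuel D (\<lambda>u. g (swap_cells V q y u)) y f = (\<lambda>u. g (slide_fuel D (swap_cells V q y) y f u))"
    if "y \<in> D" "y \<in> nbrs q" for y
  proof (rule Suc.IH)
    have sub: "swap_cells V q y ` {u \<in> D. cle y u} \<subseteq> swap_cells V q y ` {u \<in> D. cle q u}"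
      using that cle_nbrs cle_trans by blast
    also have "\<dots> = V ` {u \<in> D. cle q u}"
      using that cle_nbrs Suc.prems by (intro image_swap_cells) auto
    finally show "strict_mono_on (swap_cells V q y ` {u \<in> D. cle y u}) g"
      using Suc.prems(2) by (auto intro: monotone_on_subset)
  qed (use that in auto)
  have 1: "cle q (i, Suc j)" "cle q (Suc i, j)" "cle q (i, j)" by (auto simp: q cle_def)
  have 2: "(i, Suc j) \<in> nbrs q" "(Suc i, j) \<in> nbrs q" by (auto simp: q nbrs_def)
  show ?case
    using lt[OF _ _ 1(1) 1(2)] lt[OF _ _ 1(1) 1(3)] lt[OF _ _ 1(2) 1(3)] IH[OF _ 2(1)] IH[OF _ 2(2)]
      Suc.prems(1) unfolding q
    by (auto simp: Let_def sw)
qed simp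

lemma slides_inj_on:
  assumes "slides D V q W x" "q \<in> D" "inj_on V D"
  shows "inj_on W D" "x \<in> D"
  using assms
  by (induction) (auto simp: exch_def intro: inj_on_swap_cells)

section \<open>Backward paths\<close>

text \<open>In the column-by-column order these are the cells from \<open>(i, j)\<close> on: the
  part that is sorted once the slide at \<open>(i, j)\<close> is done.\<close>

definition tail :: "cell set \<Rightarrow> nat \<Rightarrow> nat \<Rightarrow> cell set" where
  "tail D i j = {(a, b) \<in> D. j < b \<or> b = j \<and> i \<le> a}"

text \<open>The state in the middle of a slide, whose moving entry is in the cell \<open>q\<close>.\<close>

definition hole_incr :: "cell set \<Rightarrow> tabl \<Rightarrow> cell \<Rightarrow> bool" where
  "hole_incr R V q \<longleftrightarrow> q \<in> R \<and> incr_on (R - {q}) V \<and> (\<forall>u\<in>R. cle u q \<longrightarrow> u \<noteq> q \<longrightarrow> V u < V q)"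

lemma incr_onD: "incr_on A V \<Longrightarrow> u \<in> A \<Longrightarrow> w \<in> A \<Longrightarrow> cle u w \<Longrightarrow> u \<noteq> w \<Longrightarrow> V u < V w"
  by (auto simp: incr_on_def)

text \<open>The backward path leaves \<open>(a, b)\<close> to the north if \<open>goN\<close> holds there and to the west otherwise.\<close>

definition goN :: "cell set \<Rightarrow> tabl \<Rightarrow> nat \<Rightarrow> nat \<Rightarrow> bool" where
  "goN R V a b \<longleftrightarrow> (a - 1, b) \<in> R \<and> ((a, b - 1) \<in> R \<longrightarrow> V (a, b - 1) < V (a - 1, b))"

text \<open>The largest \<open>d\<close> with \<open>1 \<le> d \<le> b\<close> and
  \<open>G d\<close>. Columns start at 1, so 0 can stand for the absence of such a
  \<open>d\<close>.\<close>

primrec last_at :: "(nat \<Rightarrow> bool) \<Rightarrow> nat \<Rightarrow> nat" where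
  "last_at G 0 = 0"
| "last_at G (Suc b) = (if G (Suc b) then Suc b else last_at G b)"

text \<open>With \<open>G = goN R V\<close>, this is the column in which the backward path from \<open>(t, b)\<close> enters row \<open>r\<close> from below.
  Its monotonicity in \<open>b\<close> says that backward paths do not cross.\<close>

primrec arr :: "(nat \<Rightarrow> nat \<Rightarrow> bool) \<Rightarrow> nat \<Rightarrow> nat \<Rightarrow> nat \<Rightarrow> nat" where
  "arr G r 0 b = b"
| "arr G r (Suc t) b = (if Suc t \<le> r then b else arr G r t (last_at (G (Suc t)) b))"

lemma last_at_le: "last_at G b \<le> b"
  by (induction b) auto

lemma last_at_ge: "G d \<Longrightarrow> d \<le> b \<Longrightarrow> d \<le> last_at G b"
  by (induction b) (auto simp: le_Suc_eq)

lemma last_at_holds: "0 < last_at G b \<Longrightarrow> G (last_at G b)"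
  by (induction b) (auto split: if_splits)

lemma last_at_greater: "last_at G b < d \<Longrightarrow> d \<le> b \<Longrightarrow> \<not> G d"
  using last_at_ge[of G d b] by auto

lemma last_at_mono: "b \<le> b' \<Longrightarrow> last_at G b \<le> last_at G b'"
  by (metis last_at_ge last_at_holds last_at_le le0 le_trans not_gr_zero)

lemma last_at_eqI: "G d \<Longrightarrow> d \<le> b \<Longrightarrow> (\<And>d'. d < d' \<Longrightarrow> d' \<le> b \<Longrightarrow> \<not> G d') \<Longrightarrow> last_at G b = d"
  by (metis last_at_ge last_at_holds last_at_le le_antisym le_zero_eq linorder_not_le not_gr_zero)

lemma arr_self [simp]: "t \<le> r \<Longrightarrow> arr G r t b = b"
  by (cases t) auto

lemma arr_mono: "b \<le> b' \<Longrightarrow> arr G r t b \<le> arr G r t b'"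
  by (induction t arbitrary: b b') (auto simp: last_at_mono)

lemma arr_le: "arr G r t b \<le> b"
proof (induction t arbitrary: b)
  case (Suc t)
  show ?case using Suc[of "last_at (G (Suc t)) b"] last_at_le[of "G (Suc t)" b] by auto
qed simp

lemma arr_comp: "r \<le> s \<Longrightarrow> s \<le> t \<Longrightarrow> arr G r t b = arr G r s (arr G s t b)"
  by (induction t arbitrary: b) (auto simp: le_Suc_eq)

lemma arr_step: "r < t \<Longrightarrow> arr G r t b = last_at (G (Suc r)) (arr G (Suc r) t b)"
  using arr_comp[of r "Suc r" t G b] by simp

lemma arr_cong:
  assumes "\<And>s d. r < s \<Longrightarrow> s \<le> t \<Longrightarrow> G s d = G' s d"
  shows "arr G r t b = arr G' r t b"
  using assms
proof (induction t arbitrary: b)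
  case (Suc t)
  have "last_at (G (Suc t)) b = last_at (G' (Suc t)) b" if "r < Suc t" for b
    using Suc.prems[of "Suc t"] that by (induction b) auto
  with Suc show ?case by auto
qed simp

lemma arr_ge:
  assumes "\<And>s. r < s \<Longrightarrow> s \<le> t \<Longrightarrow> G s j" "j \<le> b"
  shows "j \<le> arr G r t b"
  using assms
proof (induction t arbitrary: b)
  case (Suc t)
  then show ?case using last_at_ge[of "G (Suc t)" j b] by auto
qed simp

text \<open>The tableau reached from \<open>S\<close> by moving the entry of the cell \<open>(r, e r)\<close> backwards to \<open>q\<close>
  along the lattice path which occupies the columns \<open>e (t - 1), \<dots>, e t\<close> of each row \<open>t\<close>.\<close>

definition unslide :: "(nat \<Rightarrow> nat) \<Rightarrow> nat \<Rightarrow> tabl \<Rightarrow> cell \<Rightarrow> tabl" where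
  "unslide e r S q u = (let (a, b) = q; (t, d) = u in
     if u = q then S (r, e r)
     else if (a < t \<and> t \<le> r \<and> e (t - 1) < d \<and> d \<le> e t) \<or> (t = a \<and> b < d \<and> d \<le> e a) then S (t, d - 1)
     else if a < t \<and> t \<le> r \<and> d = e (t - 1) then S (t - 1, d)
     else S u)"

lemma unslide_end: "unslide e r S (r, e r) = S"
  by (auto simp: unslide_def fun_eq_iff)

lemma unslide_W:
  assumes "b < e a"
  shows "unslide e r S (a, b) = swap_cells (unslide e r S (a, Suc b)) (a, b) (a, Suc b)"
  using assms by (auto simp: unslide_def swap_cells_def fun_eq_iff)

lemma unslide_N:
  assumes "e a = b" "a < r"
  shows "unslide e r S (a, b) = swap_cells (unslide e r S (Suc a, b)) (a, b) (Suc a, b)"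
  using assms by (auto simp: unslide_def swap_cells_def fun_eq_iff not_less_eq less_Suc_eq)

section \<open>Slides and their reversal in a Young diagram\<close>

locale young =
  fixes D :: "cell set"
  assumes fin: "finite D"
    and pos: "(a, b) \<in> D \<Longrightarrow> 1 \<le> a \<and> 1 \<le> b"
    and down: "(a, b) \<in> D \<Longrightarrow> 1 \<le> a' \<Longrightarrow> a' \<le> a \<Longrightarrow> 1 \<le> b' \<Longrightarrow> b' \<le> b \<Longrightarrow> (a', b') \<in> D"
begin

abbreviation R :: "nat \<Rightarrow> nat \<Rightarrow> cell set" where "R i j \<equiv> tail D i j"

lemma tail_sub: "R i j \<subseteq> D" by (auto simp: tail_def)

lemma tailD: "u \<in> R i j \<Longrightarrow> u \<in> D" by (auto simp: tail_def)

lemma tail_up: "q \<in> R i j \<Longrightarrow> w \<in> D \<Longrightarrow> cle q w \<Longrightarrow> w \<in> R i j"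
  by (auto simp: tail_def cle_def)

lemma tail_nbr_above:
  assumes "u \<in> R i j" "w \<in> R i j" "cle u w" "u \<noteq> w"
  obtains y where "y \<in> R i j" "y \<in> nbrs u" "cle y w"
proof (cases "snd u < snd w")
  case True
  have "(fst u, Suc (snd u)) \<in> R i j"
    using assms True pos down[of "fst w" "snd w" "fst u" "Suc (snd u)"]
    by (auto simp: tail_def cle_def)
  then show thesis using that assms True by (auto simp: nbrs_def cle_def)
next
  case False
  then have *: "fst u < fst w" "snd u = snd w" using assms by (auto simp: cle_def prod_eq_iff)
  have "(Suc (fst u), snd u) \<in> R i j"
    using assms * pos down[of "fst w" "snd w" "Suc (fst u)" "snd u"]
    by (auto simp: tail_def cle_def)
  then show thesis using that assms * by (auto simp: nbrs_def cle_def)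
qed

lemma tail_nbr_below:
  assumes "u \<in> R i j" "w \<in> R i j" "cle u w" "u \<noteq> w"
  obtains y where "y \<in> R i j" "w \<in> nbrs y" "cle u y"
proof (cases "fst u < fst w")
  case True
  obtain a where a: "fst w = Suc a" using True by (cases "fst w") auto
  have "1 \<le> a" using True a assms(1) pos[of "fst u" "snd u"] by (auto simp: tail_def)
  then have "(a, snd w) \<in> R i j"
    using assms True a pos down[of "fst w" "snd w" "a" "snd w"]
    by (auto simp: tail_def cle_def)
  then show thesis using that[of "(a, snd w)"] assms True a by (auto simp: nbrs_def cle_def prod_eq_iff)
next
  case False
  then have *: "fst u = fst w" "snd u < snd w" using assms by (auto simp: cle_def prod_eq_iff)
  obtain b where b: "snd w = Suc b" using * by (cases "snd w") auto
  have "1 \<le> b" using * b assms(1) pos[of "fst u" "snd u"] by (auto simp: tail_def)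
  then have "(fst w, b) \<in> R i j"
    using assms * b pos down[of "fst w" "snd w" "fst w" "b"]
    by (auto simp: tail_def cle_def)
  then show thesis using that[of "(fst w, b)"] assms * b by (auto simp: nbrs_def cle_def prod_eq_iff)
qed

text \<open>The new comparisons concern the entry that moves into \<open>q\<close>. A cell beyond
  \<open>q\<close> lies weakly beyond a neighbour of \<open>q\<close>, whose entry is at least
  \<open>V y\<close>; and a cell before \<open>q\<close> is also before \<open>y\<close>.\<close>

lemma exch_hole_incr:
  assumes V: "hole_incr (R i j) V q" and ex: "exch D V q y" and inj: "inj_on V D"
  shows "hole_incr (R i j) (swap_cells V q y) y"
proof -
  let ?R = "R i j" and ?V = "swap_cells V q y"
  have q: "q \<in> ?R" and inc: "\<And>u w. u \<in> ?R \<Longrightarrow> w \<in> ?R \<Longrightarrow> u \<noteq> q \<Longrightarrow> w \<noteq> q \<Longrightarrow> cle u w \<Longrightarrow> u \<noteq> w \<Longrightarrow> V u < V w"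
    and lo: "\<And>u. u \<in> ?R \<Longrightarrow> cle u q \<Longrightarrow> u \<noteq> q \<Longrightarrow> V u < V q"
    using V by (auto simp: hole_incr_def incr_on_def)
  have y: "y \<in> D" "y \<in> nbrs q" "\<And>w. w \<in> D \<Longrightarrow> w \<in> nbrs q \<Longrightarrow> V y \<le> V w" "V y < V q"
    using ex by (auto simp: exch_def)
  have yc: "cle q y" "y \<noteq> q" "\<not> cle y q" using cle_nbrs y by auto
  have yR: "y \<in> ?R" using tail_up q y(1) yc by blast
  have "?V u < ?V w" if uw: "u \<in> ?R" "w \<in> ?R" "u \<noteq> y" "w \<noteq> y" "cle u w" "u \<noteq> w" for u w
  proof (cases "u = q")
    case True
    from uw(1,2,5,6) obtain y2 where y2: "y2 \<in> ?R" "y2 \<in> nbrs u" "cle y2 w" by (rule tail_nbr_above)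
    have "V y2 \<le> V w" using inc[of y2 w] y2 True uw cle_nbrs(2)[of y2 q] by (cases "y2 = w") auto
    moreover have "V y \<le> V y2" by (rule y(3)[OF tailD[OF y2(1)] y2(2)[unfolded True]])
    moreover have "V y \<noteq> V w" using inj_onD[OF inj _ y(1) tailD[OF uw(2)]] uw(4) by metis
    ultimately show ?thesis using True uw by auto
  next
    case False
    show ?thesis
    proof (cases "w = q")
      case True
      then show ?thesis using False uw inc[of u y] yR yc cle_trans[of u q y] by auto
    next
      case wq: False
      then show ?thesis using False uw inc by auto
    qed
  qed
  moreover have "?V u < ?V y" if "u \<in> ?R" "cle u y" "u \<noteq> y" for u
    using that inc[of u y] y yR yc by (cases "u = q") auto
  ultimately show ?thesis using yR by (auto simp: hole_incr_def incr_on_def)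
qed

text \<open>To restore the order, the larger of the entries north and west of \<open>y\<close> has
  to move into \<open>y\<close>. The forward slide from \<open>q\<close> then chooses
  \<open>y\<close> again, since the other neighbour of \<open>q\<close> exceeds \<open>V q\<close>,
  the entry now in \<open>y\<close>.\<close>

lemma exch_back:
  assumes V: "hole_incr (R i j) V y" and q: "q \<in> R i j" "y \<in> nbrs q"
    and mx: "\<And>u. u \<in> R i j \<Longrightarrow> y \<in> nbrs u \<Longrightarrow> V u \<le> V q" and inj: "inj_on V D"
  shows "hole_incr (R i j) (swap_cells V q y) q" "exch D (swap_cells V q y) q y"
proof -
  let ?R = "R i j" and ?V = "swap_cells V q y"
  have y: "y \<in> ?R" and inc: "\<And>u w. u \<in> ?R \<Longrightarrow> w \<in> ?R \<Longrightarrow> u \<noteq> y \<Longrightarrow> w \<noteq> y \<Longrightarrow> cle u w \<Longrightarrow> u \<noteq> w \<Longrightarrow> V u < V w"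
    and lo: "\<And>u. u \<in> ?R \<Longrightarrow> cle u y \<Longrightarrow> u \<noteq> y \<Longrightarrow> V u < V y"
    using V by (auto simp: hole_incr_def incr_on_def)
  have yc: "cle q y" "y \<noteq> q" "\<not> cle y q" using cle_nbrs q by auto
  have yD: "y \<in> D" using y tail_sub by auto
  have "?V u < ?V w" if uw: "u \<in> ?R" "w \<in> ?R" "u \<noteq> q" "w \<noteq> q" "cle u w" "u \<noteq> w" for u w
  proof (cases "w = y")
    case True
    from uw(1,2,5,6) obtain y2 where y2: "y2 \<in> ?R" "w \<in> nbrs y2" "cle u y2" by (rule tail_nbr_below)
    have "V u \<le> V y2" using inc[of u y2] y2 True uw cle_nbrs(2)[of y y2] by (cases "y2 = u") auto
    moreover have "V y2 \<le> V q" using y2 mx True by auto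
    moreover have "V u \<noteq> V q" using inj_onD[OF inj _ tailD[OF uw(1)] tailD[OF q(1)]] uw(3) by metis
    ultimately show ?thesis using True uw by auto
  next
    case False
    show ?thesis
    proof (cases "u = y")
      case True
      then show ?thesis using False uw inc[of q w] q yc cle_trans[of q y w] by auto
    next
      case wq: False
      then show ?thesis using False uw inc by auto
    qed
  qed
  moreover have "?V u < ?V q" if "u \<in> ?R" "cle u q" "u \<noteq> q" for u
    using that lo[of u] yc cle_trans[of u q y] by (cases "u = y") auto
  ultimately show "hole_incr (R i j) (swap_cells V q y) q" using q by (auto simp: hole_incr_def incr_on_def)
  have "V q \<le> ?V w" if "w \<in> D" "w \<in> nbrs q" "w \<noteq> y" for w
  proof -
    have "cle q w" "w \<noteq> q" using that cle_nbrs by auto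
    moreover have "w \<in> ?R" using tail_up that(1) q(1) calculation by blast
    ultimately show ?thesis using that inc[of q w] q yc by auto
  qed
  then show "exch D ?V q y" using q yD lo[of q] yc by (fastforce simp: exch_def)
qed

lemma hole_incr_terminal:
  assumes V: "hole_incr (R i j) V q" and t: "\<And>w. w \<in> D \<inter> nbrs q \<Longrightarrow> V q \<le> V w" and inj: "inj_on V D"
  shows "incr_on (R i j) V"
  unfolding incr_on_def
proof (intro ballI impI)
  fix u w assume uw: "u \<in> R i j" "w \<in> R i j" "cle u w" "u \<noteq> w"
  show "V u < V w"
  proof (cases "u = q")
    case True
    from uw obtain y2 where y2: "y2 \<in> R i j" "y2 \<in> nbrs u" "cle y2 w" by (rule tail_nbr_above)
    have y2q: "y2 \<noteq> q" "w \<noteq> q" using cle_nbrs y2 True uw by auto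
    have "V y2 \<le> V w" using V y2 y2q uw by (cases "y2 = w") (auto simp: hole_incr_def incr_on_def intro: less_imp_le)
    moreover have "V q \<le> V y2" using t[of y2] y2(2)[unfolded True] tailD[OF y2(1)] by blast
    moreover have "V u \<noteq> V w" using inj_onD[OF inj _ tailD[OF uw(1)] tailD[OF uw(2)]] uw(4) by metis
    ultimately show ?thesis using True by auto
  next
    case False
    then show ?thesis using V uw by (cases "w = q") (auto simp: hole_incr_def incr_on_def)
  qed
qed

lemma slides_hole_incr:
  assumes "slides D V q W x" "hole_incr (R i j) V q" "inj_on V D"
  shows "hole_incr (R i j) W x"
  using assms
proof induction
  case (step V q y W x)
  have "q \<in> D" "y \<in> D" using step tail_sub by (auto simp: hole_incr_def exch_def)
  then show ?case using step exch_hole_incr inj_on_swap_cells by blast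
qed

lemma tail_Suc: "(i, j) \<in> D \<Longrightarrow> R i j - {(i, j)} = R (Suc i) j"
  by (auto simp: tail_def)

text \<open>No other cell of the tail is weakly northwest of its first cell, so a moving entry that
  is still there imposes no condition.\<close>

lemma hole_incr_start:
  assumes "(i, j) \<in> D"
  shows "hole_incr (R i j) V (i, j) \<longleftrightarrow> incr_on (R (Suc i) j) V"
proof -
  have "u = (i, j)" if "u \<in> R i j" "cle u (i, j)" for u
    using that by (auto simp: tail_def cle_def)
  then show ?thesis using assms by (auto simp: hole_incr_def tail_Suc) (auto simp: tail_def)
qed

text \<open>The easternmost column of the backward path from \<open>(r, c)\<close> in row
  \<open>a\<close>; the westernmost one is the value for \<open>a - 1\<close>. The default
  \<open>j\<close> for \<open>a < i\<close> extends this to row \<open>i\<close>, where the path has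
  to end in \<open>(i, j)\<close>.\<close>

definition ecol :: "nat \<Rightarrow> nat \<Rightarrow> tabl \<Rightarrow> nat \<Rightarrow> nat \<Rightarrow> nat \<Rightarrow> nat" where
  "ecol i j S r c a = (if a < i then j else arr (goN (R i j) S) a r c)"

text \<open>Columns beyond \<open>j\<close> are sorted in all their rows, so a backward path may
  escape from row \<open>i\<close> to the north before it comes to column \<open>j\<close>. The last
  conjunct excludes this.\<close>

definition reaches :: "nat \<Rightarrow> nat \<Rightarrow> tabl \<Rightarrow> nat \<Rightarrow> nat \<Rightarrow> bool" where
  "reaches i j S r c \<longleftrightarrow> (r, c) \<in> R i j \<and> i \<le> r \<and>
     (\<forall>d. j < d \<longrightarrow> d \<le> arr (goN (R i j) S) i r c \<longrightarrow> \<not> goN (R i j) S i d)"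

text \<open>The tail has no cell west of column \<open>j\<close>, so a backward path in that column
  can only go north.\<close>

lemma goN_first:
  assumes "1 \<le> i" "(t, j) \<in> D" "i < t"
  shows "goN (R i j) S t j"
  using assms pos[of t "j - 1"] pos[of t j] down[of t j "t - 1" j] by (auto simp: goN_def tail_def)

lemma arr_goN_ge:
  assumes "1 \<le> i" "i \<le> r" "(t, j) \<in> D" "j \<le> b"
  shows "j \<le> arr (goN (R i j) S) r t b"
proof (rule arr_ge)
  show "goN (R i j) S s j" if "r < s" "s \<le> t" for s
    using that assms down[of t j s j] pos[of t j] by (intro goN_first) auto
qed (use assms in auto)

lemma tailI: "1 \<le> a' \<Longrightarrow> i \<le> a' \<Longrightarrow> 1 \<le> j \<Longrightarrow> j \<le> b' \<Longrightarrow> (a, b) \<in> D \<Longrightarrow> a' \<le> a \<Longrightarrow> b' \<le> b \<Longrightarrow> (a', b') \<in> R i j"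
  using down[of a b a' b'] by (auto simp: tail_def)

lemma ecol_facts:
  fixes S r c i j
  defines "e \<equiv> ecol i j S r c"
  assumes i: "1 \<le> i" "1 \<le> j" and re: "reaches i j S r c"
  shows ecol_pred: "e (i - 1) = j"
    and ecol_end: "e r = c"
    and ecol_mono: "\<And>a. i \<le> a \<Longrightarrow> a \<le> r \<Longrightarrow> e (a - 1) \<le> e a"
    and ecol_ge: "\<And>a. a \<le> r \<Longrightarrow> j \<le> e a"
    and ecol_W: "\<And>a d. i \<le> a \<Longrightarrow> a \<le> r \<Longrightarrow> e (a - 1) < d \<Longrightarrow> d \<le> e a \<Longrightarrow> \<not> goN (R i j) S a d"
    and ecol_N: "\<And>a. i < a \<Longrightarrow> a \<le> r \<Longrightarrow> goN (R i j) S a (e (a - 1))"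
    and ecol_tail: "\<And>a. i \<le> a \<Longrightarrow> a \<le> r \<Longrightarrow> (a, e a) \<in> R i j"
    and ecol_pos: "\<And>a. a \<le> r \<Longrightarrow> 0 < e a"
proof -
  let ?G = "goN (R i j) S"
  have rc: "(r, c) \<in> D" "i \<le> r" "j \<le> c" using re by (auto simp: reaches_def tail_def)
  have rj: "(r, j) \<in> D" using down[OF rc(1), of r j] pos[OF rc(1)] rc i by auto
  show "e (i - 1) = j" using i by (auto simp: e_def ecol_def)
  show "e r = c" using rc by (simp add: e_def ecol_def)
  show ge: "j \<le> e a" if "a \<le> r" for a
    using arr_goN_ge[OF i(1) _ rj rc(3)] by (auto simp: e_def ecol_def)
  then show "0 < e a" if "a \<le> r" for a using that i by fastforce
  have st: "e (a - 1) = last_at (?G a) (e a)" if "i < a" "a \<le> r" for a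
    using that arr_step[of "a - 1" r ?G c] by (auto simp: e_def ecol_def)
  show "e (a - 1) \<le> e a" if "i \<le> a" "a \<le> r" for a
    using that st[of a] last_at_le[of "?G a"] ge[of a] i
    by (cases "a = i") (auto simp: e_def ecol_def)
  show "\<not> ?G a d" if "i \<le> a" "a \<le> r" "e (a - 1) < d" "d \<le> e a" for a d
  proof (cases "a = i")
    case True
    with that re i show ?thesis by (auto simp: e_def ecol_def reaches_def)
  next
    case False
    with that st[of a] last_at_greater[of "?G a" "e a" d] show ?thesis by auto
  qed
  show "?G a (e (a - 1))" if "i < a" "a \<le> r" for a
  proof -
    have "0 < last_at (?G a) (e a)" using that st[of a] ge[of "a - 1"] i by linarith
    then show ?thesis using last_at_holds that st[of a] by simp
  qed
  show "(a, e a) \<in> R i j" if "i \<le> a" "a \<le> r" for a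
    using that ge[of a] i rc arr_le[of ?G a r c]
    by (intro tailI[of a i j "e a" r c]) (auto simp: e_def ecol_def)
qed

text \<open>The path of a slide can be read off its result: after an exchange of \<open>q\<close>
  with \<open>y\<close>, the entry left in \<open>q\<close> came from \<open>y\<close> and exceeds
  the entry of the other predecessor of \<open>y\<close>. So the backward path leaves
  \<open>y\<close> towards \<open>q\<close>.\<close>

lemma slides_path:
  assumes "slides D V q W x" "hole_incr (R i j) V q" "inj_on V D" "i \<le> fst q" "x = (r, c)"
  shows "case q of (a, b) \<Rightarrow> a \<le> r \<and> b \<le> ecol i j W r c a \<and>
     (\<forall>d. b < d \<longrightarrow> d \<le> ecol i j W r c a \<longrightarrow> \<not> goN (R i j) W a d) \<and>
     V = unslide (ecol i j W r c) r W (a, b)"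
  using assms
proof induction
  case (refl V q)
  have "ecol i j V r c r = c" using refl by (auto simp: ecol_def)
  then show ?case using refl unslide_end[of "ecol i j V r c" r V] by auto
next
  case (step V q y W x)
  let ?e = "ecol i j W r c" and ?G = "goN (R i j) W" and ?V = "swap_cells V q y"
  obtain a b where q: "q = (a, b)" by (cases q)
  have y: "y \<in> D" "y \<in> nbrs q" using step(1) by (auto simp: exch_def)
  have qR: "q \<in> R i j" and ia: "i \<le> a" using step q by (auto simp: hole_incr_def)
  have qD: "q \<in> D" using qR tailD by blast
  have yR: "y \<in> R i j" using tail_up qR y cle_nbrs by blast
  have inc: "V u < V w" if "u \<in> R i j" "w \<in> R i j" "u \<noteq> q" "w \<noteq> q" "cle u w" "u \<noteq> w" for u w
    using that step.prems by (auto simp: hole_incr_def incr_on_def)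
  have V': "hole_incr (R i j) ?V y" "inj_on ?V D"
    using exch_hole_incr step inj_on_swap_cells qD y by auto
  have iy: "i \<le> fst y" using y ia q by (auto simp: nbrs_def)
  obtain a' b' where y': "y = (a', b')" by (cases y)
  note IH = step.IH[OF V' iy \<open>x = (r, c)\<close>, unfolded y' prod.case]
  \<comment> \<open>The rest of the slide starts in \<open>y\<close> and moves southeast, so the
    predecessors of \<open>y\<close> already carry their final entries.\<close>
  have V'eq: "?V u = W u" if "y \<in> nbrs u" for u
    using IH that by (cases u) (auto simp: nbrs_def unslide_def y')
  have Wq: "W q = V y" using V'eq y by (metis swap_cells_simps(2))
  from y(2) consider (right) "y = (a, Suc b)" | (below) "y = (Suc a, b)" by (auto simp: nbrs_def q)
  then show ?case
  proof cases
    case right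
    have "\<not> ?G a (Suc b)"
    proof
      assume g: "?G a (Suc b)"
      then have u: "(a - 1, Suc b) \<in> R i j" "W q < W (a - 1, Suc b)" using qR by (auto simp: goN_def q)
      have a1: "a - 1 < a" using u(1) tailD[OF u(1)] pos[of "a - 1" "Suc b"] by linarith
      then have "W (a - 1, Suc b) = V (a - 1, Suc b)"
        using V'eq[of "(a - 1, Suc b)"] by (auto simp: right nbrs_def swap_cells_def q)
      moreover have "V (a - 1, Suc b) < V y"
        using a1 u yR by (intro inc) (auto simp: right q cle_def)
      ultimately show False using u Wq by simp
    qed
    moreover have "V = unslide ?e r W (a, b)"
    proof -
      have "unslide ?e r W (a, b) = swap_cells (unslide ?e r W y) q y"
        using IH right y' unslide_W[of b ?e a r W] by (simp add: q)
      also have "unslide ?e r W y = ?V" using IH y' by simp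
      finally show ?thesis by simp
    qed
    ultimately show ?thesis using IH right y' by (auto simp: q le_less_Suc_eq) (metis Suc_lessI)
  next
    case below
    have g: "?G (Suc a) b"
      unfolding goN_def
    proof (intro conjI impI)
      show "(Suc a - 1, b) \<in> R i j" using qR q by simp
      assume u: "(Suc a, b - 1) \<in> R i j"
      have b1: "b - 1 < b" using pos[of "Suc a" "b - 1"] tailD[OF u] by linarith
      then have "W (Suc a, b - 1) = V (Suc a, b - 1)"
        using V'eq[of "(Suc a, b - 1)"] by (auto simp: below nbrs_def swap_cells_def q)
      moreover have "V (Suc a, b - 1) < V y"
        using b1 u yR by (intro inc) (auto simp: below q cle_def)
      ultimately show "W (Suc a, b - 1) < W (Suc a - 1, b)" using Wq q by simp
    qed
    have "?e a = last_at (?G (Suc a)) (?e (Suc a))"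
      using IH ia arr_step[of a r ?G c] below y' by (auto simp: ecol_def)
    also have "\<dots> = b" using IH below y' g by (intro last_at_eqI) auto
    finally have ea: "?e a = b" .
    moreover have "V = unslide ?e r W (a, b)"
    proof -
      have "unslide ?e r W (a, b) = swap_cells (unslide ?e r W y) q y"
        using IH below y' unslide_N[of ?e a b r W] ea by (simp add: q)
      also have "unslide ?e r W y = ?V" using IH y' by simp
      finally show ?thesis by simp
    qed
    ultimately show ?thesis using IH below y' by (auto simp: q)
  qed
qed

lemma slide_reaches:
  assumes ij: "(i, j) \<in> D" and inc: "incr_on (R (Suc i) j) U" and inj: "inj_on U D"
    and sl: "slides D U (i, j) S (r, c)"
  shows "reaches i j S r c" "U = unslide (ecol i j S r c) r S (i, j)" "hole_incr (R i j) S (r, c)"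
proof -
  have h: "hole_incr (R i j) U (i, j)" using hole_incr_start ij inc by simp
  note p = slides_path[OF sl h inj _ HOL.refl, unfolded prod.case fst_conv, OF order.refl]
  show hx: "hole_incr (R i j) S (r, c)" using slides_hole_incr[OF sl h inj] .
  show "U = unslide (ecol i j S r c) r S (i, j)" using p by simp
  show "reaches i j S r c" using p hx by (auto simp: reaches_def hole_incr_def ecol_def)
qed

text \<open>Converse of \<open>slides_path\<close>: in each cell the backward path turns to the
  larger predecessor, which is the condition of \<open>exch_back\<close>. The induction runs from
  the end cell \<open>(r, c)\<close> back towards \<open>(i, j)\<close>.\<close>

lemma unslide_slides:
  assumes i: "1 \<le> i" "1 \<le> j" and re: "reaches i j S r c" and inc: "incr_on (R i j) S" and inj: "inj_on S D"
    and q: "i \<le> a" "a \<le> r" "ecol i j S r c (a - 1) \<le> b" "b \<le> ecol i j S r c a"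
  shows "let V = unslide (ecol i j S r c) r S (a, b) in
     hole_incr (R i j) V (a, b) \<and> inj_on V D \<and> V ` D = S ` D \<and> (\<forall>u. u \<notin> D \<longrightarrow> V u = S u) \<and> slides D V (a, b) S (r, c)"
  using q
proof (induction "(r + c) - (a + b)" arbitrary: a b rule: less_induct)
  case less
  let ?e = "ecol i j S r c" and ?G = "goN (R i j) S"
  note ef = ecol_facts[OF i re]
  have mon: "?e a \<le> c" if "i \<le> a" for a using arr_le that by (auto simp: ecol_def)
  have bc: "b \<le> c" using mon less.prems by fastforce
  have bj: "j \<le> b" using ef(4)[of "a - 1"] less.prems by (meson diff_le_self le_trans)
  let ?V = "unslide ?e r S"
  have aeD: "(a, ?e a) \<in> D" using ef(7)[of a] tailD less.prems by blast
  have qR: "(a, b) \<in> R i j"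
    using tailI[of a i j b a "?e a"] aeD less.prems bj i by auto
  have main: ?case if succ: "(a', b') = (a, Suc b) \<or> (a', b') = (Suc a, b)"
       "a' \<le> r" "?e (a' - 1) \<le> b'" "b' \<le> ?e a'"
     and eq: "?V (a, b) = swap_cells (?V (a', b')) (a, b) (a', b')"
     and mx: "\<And>u. u \<in> R i j \<Longrightarrow> (a', b') \<in> nbrs u \<Longrightarrow> S u \<le> S (a, b)"
     for a' b'
  proof -
    have ia': "i \<le> a'" using succ less.prems by auto
    have "b' \<le> c" using mon[of a'] succ ia' by linarith
    then have "r + c - (a' + b') < r + c - (a + b)" using succ(1,2) by auto
    note IH = less.hyps[OF this ia' succ(2-4), unfolded Let_def]
    have hV: "hole_incr (R i j) (?V (a', b')) (a', b')" and iV: "inj_on (?V (a', b')) D"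
       and sV: "slides D (?V (a', b')) (a', b') S (r, c)" and img: "?V (a', b') ` D = S ` D" and out: "\<And>u. u \<notin> D \<Longrightarrow> ?V (a', b') u = S u" using IH by auto
    have nb: "(a', b') \<in> nbrs (a, b)" using succ by (auto simp: nbrs_def)
    have Seq: "?V (a', b') u = S u" if "(a', b') \<in> nbrs u" for u
      using that by (cases u) (auto simp: nbrs_def unslide_def)
    have mx': "?V (a', b') u \<le> ?V (a', b') (a, b)" if "u \<in> R i j" "(a', b') \<in> nbrs u" for u
      using Seq[OF nb] Seq[OF that(2)] mx[OF that] by simp
    have D': "(a', b') \<in> D" "(a, b) \<in> D" using hV qR tailD by (auto simp: hole_incr_def)
    note eb = exch_back[OF hV qR nb mx' iV]
    have "slides D (?V (a, b)) (a, b) S (r, c)"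
      using eb(2) sV slides.step[of D "?V (a, b)" "(a, b)" "(a', b')" S "(r, c)"] eq by simp
    moreover have "inj_on (?V (a, b)) D" using inj_on_swap_cells[OF iV] eq D' by simp
    moreover have "?V (a, b) ` D = S ` D" using image_swap_cells[of "(a, b)" D "(a', b')" "?V (a', b')"] eq D' img by simp
    moreover have "?V (a, b) u = S u" if "u \<notin> D" for u
      using out[OF that] that D' by (metis eq swap_cells_simps(3))
    ultimately show ?thesis using eb(1) eq by (simp add: Let_def)
  qed
  consider (right) "b < ?e a" | (below) "b = ?e a" "a < r" | (stop) "b = ?e a" "a = r"
    using less.prems by linarith
  then show ?case
  proof cases
    case right
    have "\<not> ?G a (Suc b)" using ef(5)[of a "Suc b"] less.prems right by auto
    show ?thesis
    proof (rule main[of a "Suc b"])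
      fix u assume u: "u \<in> R i j" "(a, Suc b) \<in> nbrs u"
      show "S u \<le> S (a, b)"
      proof (cases "u = (a, b)")
        case False
        then have "u = (a - 1, Suc b)" using u by (cases u) (auto simp: nbrs_def)
        then show ?thesis using \<open>\<not> ?G a (Suc b)\<close> u qR by (auto simp: goN_def)
      qed simp
    qed (use right less.prems unslide_W[of b ?e a r S] in auto)
  next
    case below
    have "?G (Suc a) b" using ef(6)[of "Suc a"] less.prems below by auto
    have "b \<le> ?e (Suc a)" using ef(3)[of "Suc a"] less.prems below by auto
    show ?thesis
    proof (rule main[of "Suc a" b])
      fix u assume u: "u \<in> R i j" "(Suc a, b) \<in> nbrs u"
      show "S u \<le> S (a, b)"
      proof (cases "u = (a, b)")
        case False
        then have "u = (Suc a, b - 1)" using u by (cases u) (auto simp: nbrs_def)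
        then show ?thesis using \<open>?G (Suc a) b\<close> u qR by (auto simp: goN_def)
      qed simp
    qed (use below less.prems \<open>b \<le> ?e (Suc a)\<close> unslide_N[of ?e a b r S] in auto)
  next
    case stop
    then have b: "b = c" "a = r" using ef(2) by auto
    have "?V (a, b) = S" using unslide_end[of ?e r S] stop by simp
    moreover have "hole_incr (R i j) S (r, c)"
      using inc qR b by (auto simp: hole_incr_def incr_on_def)
    ultimately show ?thesis using inj b slides.refl by (simp add: Let_def)
  qed
qed

end

lemma slides_unique:
  assumes "slides D V q W x" "\<And>w. w \<in> D \<inter> nbrs x \<Longrightarrow> W x \<le> W w"
    and "slides D V q W' x'" "\<And>w. w \<in> D \<inter> nbrs x' \<Longrightarrow> W' x' \<le> W' w"
    and "inj_on V D" "q \<in> D"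
  shows "W = W'"
  using assms
proof induction
  case (refl V q)
  from refl(2) refl(1) show ?case by cases (force simp: exch_def)+
next
  case (step V q y W x)
  from step.prems(2) show ?case
  proof cases
    case refl
    then show ?thesis using step(1) step.prems(3)[of y] by (auto simp: exch_def)
  next
    case (step y')
    have y: "y \<in> D \<inter> nbrs q" "y' \<in> D \<inter> nbrs q" "V y \<le> V y'" "V y' \<le> V y"
      using step \<open>exch D V q y\<close> unfolding exch_def by blast+
    have "y' = y" using inj_onD[OF \<open>inj_on V D\<close>, of y' y] y by simp
    then show ?thesis using step step.IH step.prems inj_on_swap_cells[OF \<open>inj_on V D\<close> \<open>q \<in> D\<close>] y by auto
  qed
qed

section \<open>Backward paths before and after a slide\<close>

context young begin

text \<open>In row \<open>i\<close>, only columns up to the one of entry matter, so the property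
  passes to all paths that enter further west.\<close>

lemma reaches_le:
  assumes "reaches i j S r c" "(t, b) \<in> R i j" "i \<le> t"
    "arr (goN (R i j) S) i t b \<le> arr (goN (R i j) S) i r c"
  shows "reaches i j S t b"
  using assms by (auto simp: reaches_def)

context
  fixes i j r c :: nat and S :: tabl
  assumes i: "1 \<le> i" "1 \<le> j" and re: "reaches i j S r c" and inc: "incr_on (R i j) S"
begin

private abbreviation "e \<equiv> ecol i j S r c"
private abbreviation "U \<equiv> unslide e r S (i, j)"
private abbreviation "GS \<equiv> goN (R i j) S"
private abbreviation "GU \<equiv> goN (R (Suc i) j) U"

text \<open>In the tableau before the slide, no backward path crosses the path of the slide: one step below it, the
  backward paths go west where the slide went east, and north where it went south.\<close>

lemma unslide_goW:
  assumes t: "i \<le> t" "t \<le> r" and b: "e (t - 1) < b" "b \<le> e t" and D: "(Suc t, b) \<in> D"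
  shows "\<not> GU (Suc t) b"
proof
  assume g: "GU (Suc t) b"
  have ej: "j \<le> e (t - 1)" using ecol_ge[OF i re, of "t - 1"] t by auto
  have W: "(Suc t, b - 1) \<in> R (Suc i) j" using tailI[OF _ _ _ _ D, of "Suc t" "Suc i" j "b - 1"] i t b ej by auto
  then have lt: "U (Suc t, b - 1) < U (t, b)" using g by (auto simp: goN_def)
  \<comment> \<open>The slide went east here and shifted this entry one cell west, to just above
    \<open>(Suc t, b - 1)\<close>.\<close>
  have "U (t, b) = S (t, b - 1)" using t b ej ecol_pred[OF i re]
    by (auto simp: unslide_def)
  moreover have "U (Suc t, b - 1) = S (Suc t, b - 1)" using t b by (auto simp: unslide_def)
  moreover have "S (t, b - 1) < S (Suc t, b - 1)"
  proof (rule incr_onD[OF inc])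
    show "(t, b - 1) \<in> R i j" using tailI[OF _ _ _ _ D, of t i j "b - 1"] i t b ej by auto
    show "(Suc t, b - 1) \<in> R i j" using tailI[OF _ _ _ _ D, of "Suc t" i j "b - 1"] i t b ej by auto
  qed (auto simp: cle_def)
  ultimately show False using lt by simp
qed

lemma unslide_goN:
  assumes t: "i \<le> t" "t < r" and D: "(Suc t, Suc (e t)) \<in> D"
  shows "GU (Suc t) (Suc (e t))"
proof -
  have ej: "j \<le> e t" "j \<le> e (t - 1)" using ecol_ge[OF i re] t by auto
  have em: "e (t - 1) \<le> e t" using ecol_mono[OF i re] t by auto
  have "U (Suc t, e t) = S (t, e t)" using t by (auto simp: unslide_def)
  moreover have "U (t, Suc (e t)) = S (t, Suc (e t))" using t ej em by (auto simp: unslide_def)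
  moreover have "S (t, e t) < S (t, Suc (e t))"
  proof (rule incr_onD[OF inc])
    show "(t, e t) \<in> R i j" using tailI[OF _ _ _ _ D, of t i j "e t"] i t ej by auto
    show "(t, Suc (e t)) \<in> R i j" using tailI[OF _ _ _ _ D, of t i j "Suc (e t)"] i t ej by auto
  qed (auto simp: cle_def)
  moreover have "(t, Suc (e t)) \<in> D" using down[OF D] t i by auto
  ultimately show ?thesis using ej by (auto simp: goN_def tail_def)
qed

lemma unslide_far:
  assumes "Suc r < a \<or> a = Suc r \<and> c < d"
  shows "GU a d = GS a d"
proof -
  have rc: "i \<le> r" "j \<le> c" using re by (auto simp: reaches_def tail_def)
  have er: "e r = c" using ecol_end[OF i re] .
  have "U (a, d - 1) = S (a, d - 1)" "U (a - 1, d) = S (a - 1, d)"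
    using assms rc er ecol_mono[OF i re, of r] by (auto simp: unslide_def)
  moreover have "(a, d - 1) \<in> R (Suc i) j \<longleftrightarrow> (a, d - 1) \<in> R i j"
    "(a - 1, d) \<in> R (Suc i) j \<longleftrightarrow> (a - 1, d) \<in> R i j"
    using assms rc by (auto simp: tail_def)
  ultimately show ?thesis by (simp add: goN_def)
qed

text \<open>One row below the path of the slide lies a barrier. By \<open>unslide_goW\<close>, a
  backward path that starts west of it cannot go north through the columns above which the slide
  went east, so it stays west down to \<open>e i\<close> and then runs to column \<open>j\<close>.
  By \<open>unslide_goN\<close>, one that starts east of it is led north before it can cross, and
  finally out of row \<open>Suc i\<close>.\<close>

lemma unslide_reaches_within:
  assumes t: "i < t" "t \<le> r" and tb: "(t, b) \<in> R (Suc i) j"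
  shows "reaches (Suc i) j U t b \<longleftrightarrow> b \<le> e (t - 1)"
proof
  have tD: "(t, b) \<in> D" and jb: "j \<le> b" using tb by (auto simp: tail_def)
  have inD: "(s, d) \<in> D" if "1 \<le> s" "s \<le> t" "1 \<le> d" "d \<le> arr GU s' t b" for s s' d
    using that arr_le[of GU s' t b] down[OF tD] by auto
  {
    assume b: "b \<le> e (t - 1)"
    have "arr GU (Suc s) t b \<le> e s" if "i \<le> s" "s \<le> t - 1" for s
      using that(2,1)
    proof (induction s rule: inc_induct)
      case base
      then show ?case using b t by auto
    next
      case (step s)
      let ?x = "arr GU (Suc (Suc s)) t b"
      have st: "Suc s < t" using step by auto
      show ?case
      proof (rule ccontr)
        assume a: "\<not> ?thesis"
        have y: "arr GU (Suc s) t b = last_at (GU (Suc (Suc s))) ?x" using arr_step[OF st] .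
        let ?y = "last_at (GU (Suc (Suc s))) ?x"
        have "e s < ?y" using a y by simp
        moreover have "GU (Suc (Suc s)) ?y" using last_at_holds calculation by (metis gr_zeroI not_less0)
        moreover have "?y \<le> ?x" using last_at_le .
        moreover have "?y \<le> e (Suc s)" using calculation step by auto
        ultimately show False
          using unslide_goW[of "Suc s" ?y] step t st inD[of "Suc (Suc s)" ?y "Suc (Suc s)"] by auto
      qed
    qed
    from this[of i] have le: "arr GU (Suc i) t b \<le> e i" using t by auto
    have "\<not> GU (Suc i) d" if "j < d" "d \<le> arr GU (Suc i) t b" for d
      using unslide_goW[of i d] that le ecol_pred[OF i re] t inD[of "Suc i" d] by auto
    then show "reaches (Suc i) j U t b" using tb t by (auto simp: reaches_def)
  next
    assume rb: "reaches (Suc i) j U t b"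
    show "b \<le> e (t - 1)"
    proof (rule ccontr)
      assume b: "\<not> b \<le> e (t - 1)"
      have "e s < arr GU (Suc s) t b" if "i \<le> s" "s \<le> t - 1" for s
        using that(2,1)
      proof (induction s rule: inc_induct)
        case base
        then show ?case using b t by auto
      next
        case (step s)
        let ?x = "arr GU (Suc (Suc s)) t b"
        have st: "Suc s < t" using step by auto
        have x: "e (Suc s) < ?x" using step by auto
        have "GU (Suc (Suc s)) (Suc (e (Suc s)))"
          using unslide_goN[of "Suc s"] step t st x inD[of "Suc (Suc s)" "Suc (e (Suc s))" "Suc (Suc s)"] by auto
        then have "Suc (e (Suc s)) \<le> last_at (GU (Suc (Suc s))) ?x"
          using last_at_ge x by (meson Suc_leI)
        moreover have "e s \<le> e (Suc s)" using ecol_mono[OF i re, of "Suc s"] step t by auto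
        ultimately show ?case using arr_step[OF st, of GU b] by auto
      qed
      from this[of i] have lt: "e i < arr GU (Suc i) t b" using t by auto
      have "GU (Suc i) (Suc (e i))" using unslide_goN[of i] t lt inD[of "Suc i" "Suc (e i)" "Suc i"] by auto
      moreover have "j \<le> e i" using ecol_ge[OF i re, of i] t by auto
      ultimately show False using rb lt by (auto simp: reaches_def)
    qed
  }
qed

text \<open>Below row \<open>Suc r\<close>, and in that row beyond column \<open>c\<close>, both
  tableaux have the same backward paths. So the question is on which side of \<open>(r, c)\<close>
  the path arrives, and this can be decided in \<open>S\<close>.\<close>

lemma unslide_reaches_beyond:
  assumes t: "r < t" and tb: "(t, b) \<in> R (Suc i) j"
  shows "reaches (Suc i) j U t b \<longleftrightarrow> arr GS r t b \<le> c"
proof -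
  have rc: "i \<le> r" "j \<le> c" using re by (auto simp: reaches_def tail_def)
  have er: "e r = c" using ecol_end[OF i re] .
  have em: "e (r - 1) \<le> c" using ecol_mono[OF i re, of r] rc er by simp
  have tD: "(t, b) \<in> D" and jb: "j \<le> b" using tb by (auto simp: tail_def)
  have tj: "(t, j) \<in> D" using down[OF tD, of t j] pos[OF tD] i jb by auto
  define x where "x = arr GU (Suc r) t b"
  have x: "x = arr GS (Suc r) t b" unfolding x_def
    using unslide_far by (intro arr_cong) auto
  have xb: "x \<le> b" using arr_le by (simp add: x_def)
  have inD: "(Suc r, d) \<in> D" if "1 \<le> d" "d \<le> x" for d
    using that xb down[OF tD] t by auto
  have S: "arr GS r t b = last_at (GS (Suc r)) x" using arr_step[OF t] x by simp
  \<comment> \<open>Beyond column \<open>c\<close> the two tableaux agree in row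
    \<open>Suc r\<close>, and \<open>unslide_goW\<close> rules out the columns after
    \<open>e (r - 1)\<close> up to \<open>c\<close>.\<close>
  have le: "d \<le> e (r - 1)" if "arr GS r t b \<le> c" "GU (Suc r) d" "d \<le> x" "0 < d" for d
  proof -
    have "d \<le> c"
    proof (rule ccontr)
      assume "\<not> d \<le> c"
      then have "GS (Suc r) d" using that unslide_far[of "Suc r" d] by auto
      then have "d \<le> arr GS r t b" using S that last_at_ge by auto
      then show False using that \<open>\<not> d \<le> c\<close> by auto
    qed
    moreover have "(Suc r, d) \<in> D" using inD that by auto
    ultimately show ?thesis using unslide_goW[OF rc(1) order.refl, of d] er that(2) by (intro leI notI) simp
  qed
  have gt: "\<exists>d. c < d \<and> d \<le> x \<and> GU (Suc r) d" if "c < arr GS r t b"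
  proof -
    have "GS (Suc r) (arr GS r t b)" using last_at_holds S that by (metis gr_zeroI not_less0)
    then show ?thesis using that unslide_far[of "Suc r" "arr GS r t b"] S last_at_le by metis
  qed
  show ?thesis
  proof (cases "r = i")
    case True
    have "reaches (Suc i) j U t b \<longleftrightarrow> (\<forall>d. j < d \<longrightarrow> d \<le> x \<longrightarrow> \<not> GU (Suc i) d)"
      using tb t True by (auto simp: reaches_def x_def)
    also have "\<dots> \<longleftrightarrow> arr GS r t b \<le> c"
    proof
      assume a: "\<forall>d. j < d \<longrightarrow> d \<le> x \<longrightarrow> \<not> GU (Suc i) d"
      show "arr GS r t b \<le> c"
      proof (rule ccontr)
        assume "\<not> ?thesis"
        then obtain d where d: "c < d" "d \<le> x" "GU (Suc r) d" using gt by auto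
        have "GU (Suc i) d" using d(3) unfolding True .
        moreover have "j < d" using d(1) rc(2) by linarith
        ultimately show False using a d(2) by blast
      qed
    next
      assume a: "arr GS r t b \<le> c"
      show "\<forall>d. j < d \<longrightarrow> d \<le> x \<longrightarrow> \<not> GU (Suc i) d"
      proof (intro allI impI notI)
        fix d assume d: "j < d" "d \<le> x" "GU (Suc i) d"
        then have "GU (Suc r) d" "0 < d" using True by simp_all
        from le[OF a this(1) d(2) this(2)] have "d \<le> e (i - 1)" unfolding True .
        then show False using ecol_pred[OF i re] d(1) by linarith
      qed
    qed
    finally show ?thesis .
  next
    case False
    define y where "y = arr GU r t b"
    have y: "y = last_at (GU (Suc r)) x" using arr_step[OF t] by (simp add: x_def y_def)
    have yj: "j \<le> y" using arr_goN_ge[of "Suc i" r t j b U] i rc False tj jb by (auto simp: y_def)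
    have yR: "(r, y) \<in> R (Suc i) j"
      using tailI[of r "Suc i" j y t b] yj rc False i tD t arr_le[of GU r t b] by (auto simp: y_def)
    have "arr GU (Suc i) t b = arr GU (Suc i) r y"
      using arr_comp[of "Suc i" r t GU b] rc False t by (simp add: y_def)
    then have "reaches (Suc i) j U t b \<longleftrightarrow> reaches (Suc i) j U r y"
      using yR tb rc False t by (auto simp: reaches_def)
    also have "\<dots> \<longleftrightarrow> y \<le> e (r - 1)" using unslide_reaches_within[OF _ _ yR] rc False by auto
    also have "\<dots> \<longleftrightarrow> arr GS r t b \<le> c"
    proof
      assume a: "arr GS r t b \<le> c"
      have "GU (Suc r) y" "y \<le> x" "0 < y" using y yj i last_at_holds last_at_le
        by (metis One_nat_def Suc_le_lessD le_trans)+
      then show "y \<le> e (r - 1)" using le a by auto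
    next
      assume a: "y \<le> e (r - 1)"
      show "arr GS r t b \<le> c"
      proof (rule ccontr)
        assume "\<not> ?thesis"
        then obtain d where "c < d" "d \<le> x" "GU (Suc r) d" using gt by auto
        then show False using last_at_ge[of "GU (Suc r)" d x] y a em by auto
      qed
    qed
    finally show ?thesis .
  qed
qed

end

section \<open>The bijection of Novelli, Pak and Stoyanovskii\<close>

text \<open>Hook functions of the Novelli--Pak--Stoyanovskii bijection, for the rows \<open>i, \<dots>, h\<close> of column \<open>j\<close>:
  instead of the offset from the cell \<open>(t, j)\<close>, which lies between minus the leg and the arm, \<open>K t\<close> is the
  absolute column \<open>j\<close> plus that offset.\<close>

definition hook_funs :: "nat \<Rightarrow> nat \<Rightarrow> nat \<Rightarrow> (nat \<Rightarrow> int) set" where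
  "hook_funs h j i = (\<Pi>\<^sub>E t\<in>{i..h}. {k. int j - int (h - t) \<le> k \<and> (int j \<le> k \<longrightarrow> (t, nat k) \<in> D)})"

text \<open>A value \<open>K t < j\<close> is a negative offset; it names no candidate cell and is
  not restricted further.\<close>

definition admissible :: "nat \<Rightarrow> nat \<Rightarrow> nat \<Rightarrow> tabl \<Rightarrow> (nat \<Rightarrow> int) set" where
  "admissible h j i S = {K \<in> hook_funs h j i. \<forall>t\<in>{i..h}. int j \<le> K t \<longrightarrow> reaches i j S t (nat (K t))}"

text \<open>Among the candidate cells \<open>(t, K t)\<close>, the last slide ended in the one whose backward path is outermost to the
  northeast.\<close>

definition chosen :: "nat \<Rightarrow> nat \<Rightarrow> nat \<Rightarrow> tabl \<Rightarrow> (nat \<Rightarrow> int) \<Rightarrow> nat \<Rightarrow> bool" where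
  "chosen h j i S K r \<longleftrightarrow> r \<in> {i..h} \<and> int j \<le> K r \<and>
     (\<forall>t\<in>{i..<r}. K t < int (arr (goN (R i j) S) t r (nat (K r)))) \<and>
     (\<forall>t\<in>{r<..h}. int j \<le> K t \<longrightarrow> arr (goN (R i j) S) r t (nat (K t)) \<le> nat (K r))"

definition hook_down :: "nat \<Rightarrow> nat \<Rightarrow> (nat \<Rightarrow> int) \<Rightarrow> nat \<Rightarrow> int" where
  "hook_down i r K t = (if i < t \<and> t \<le> r then K (t - 1) + 1 else if t = i then undefined else K t)"

text \<open>The update rule of Novelli, Pak and Stoyanovskii for a slide from \<open>(i, j)\<close>
  to \<open>(r, c)\<close>: the end column is recorded in row \<open>r\<close>, and the values above
  it move up by one row. They drop by 1, in step with the lower bound, since the leg is longer by 1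
  there.\<close>

definition hook_up :: "nat \<Rightarrow> nat \<Rightarrow> nat \<Rightarrow> (nat \<Rightarrow> int) \<Rightarrow> nat \<Rightarrow> int" where
  "hook_up i r c K t = (if i \<le> t \<and> t < r then K (Suc t) - 1 else if t = r then int c else K t)"

definition slide_sources :: "nat \<Rightarrow> nat \<Rightarrow> tabl \<Rightarrow> tabl set" where
  "slide_sources i j S = {U. U ` D = S ` D \<and> inj_on U D \<and> (\<forall>u. u \<notin> D \<longrightarrow> U u = S u) \<and>
     incr_on (R (Suc i) j) U \<and> (\<exists>x. slides D U (i, j) S x)}"

lemma finite_hook_funs: "finite (hook_funs h j i)"
  unfolding hook_funs_def
proof (rule finite_PiE)
  fix t
  have "{k. int j - int (h - t) \<le> k \<and> (int j \<le> k \<longrightarrow> (t, nat k) \<in> D)} \<subseteq>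
    {int j - int (h - t)..int j} \<union> int ` snd ` D"
  proof
    fix k assume k: "k \<in> {k. int j - int (h - t) \<le> k \<and> (int j \<le> k \<longrightarrow> (t, nat k) \<in> D)}"
    show "k \<in> {int j - int (h - t)..int j} \<union> int ` snd ` D"
    proof (cases "int j \<le> k")
      case True
      then have "k = int (snd (t, nat k))" "(t, nat k) \<in> D" using k by auto
      then show ?thesis by blast
    qed (use k in auto)
  qed
  then show "finite {k. int j - int (h - t) \<le> k \<and> (int j \<le> k \<longrightarrow> (t, nat k) \<in> D)}"
    by (rule finite_subset) (use fin in auto)
qed simp

lemma finite_admissible: "finite (admissible h j i S)"
  using finite_hook_funs by (simp add: admissible_def)

lemma chosen_unique:
  assumes "chosen h j i S K r" "chosen h j i S K r'"
  shows "r = r'"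
proof -
  have False if "chosen h j i S K r" "chosen h j i S K r'" "r < r'" for r r'
  proof -
    have "K r < int (arr (goN (R i j) S) r r' (nat (K r')))" using that by (auto simp: chosen_def)
    moreover have "arr (goN (R i j) S) r r' (nat (K r')) \<le> nat (K r)"
      using that by (auto simp: chosen_def)
    ultimately show False using that(1) by (auto simp: chosen_def)
  qed
  then show ?thesis using assms by (metis linorder_neqE_nat)
qed

lemma hook_funsD:
  assumes "K \<in> hook_funs h j i" "i \<le> t" "t \<le> h"
  shows "int j - int (h - t) \<le> K t" "int j \<le> K t \<Longrightarrow> (t, nat (K t)) \<in> D"
  using assms PiE_mem[OF assms(1)[unfolded hook_funs_def], of t] by auto

context
  fixes i j h :: nat
  assumes i: "1 \<le> i" "1 \<le> j" "i \<le> h" and height: "\<And>a. (a, j) \<in> D \<longleftrightarrow> 1 \<le> a \<and> a \<le> h"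
begin

text \<open>The rows are scanned downwards. A new candidate takes over if its backward path enters
  the row of the current choice strictly east of it; monotonicity of \<open>arr\<close> settles the
  comparison with the earlier rows. There is always a candidate, because the leg of
  \<open>(h, j)\<close> is 0 and forces a nonnegative offset in row \<open>h\<close>.\<close>

lemma chosen_exists:
  assumes K: "K \<in> hook_funs h j i"
  shows "\<exists>r. chosen h j i S K r"
proof -
  let ?G = "goN (R i j) S"
  have ge: "j \<le> arr ?G r t (nat (K t))" if "i \<le> r" "i \<le> t" "t \<le> h" "int j \<le> K t" for r t
    using arr_goN_ge[of i r t j "nat (K t)" S] that height[of t] i by auto
  have "\<exists>r\<in>{i..m}. int j \<le> K r \<and>
     (\<forall>t\<in>{i..<r}. K t < int (arr ?G t r (nat (K r)))) \<and>
     (\<forall>t\<in>{r<..m}. int j \<le> K t \<longrightarrow> arr ?G r t (nat (K t)) \<le> nat (K r))"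
    if "m \<le> h" "\<exists>t\<in>{i..m}. int j \<le> K t" for m
    using that
  proof (induction m)
    case 0
    then show ?case using i by auto
  next
    case (Suc m)
    let ?n = "Suc m"
    show ?case
    proof (cases "\<exists>t\<in>{i..m}. int j \<le> K t")
      case False
      then obtain t where t: "t \<in> {i..Suc m}" "int j \<le> K t" using Suc.prems by blast
      have "t = ?n"
      proof (rule ccontr)
        assume "t \<noteq> ?n"
        then have "t \<in> {i..m}" using t by auto
        then show False using False t by blast
      qed
      then have n: "i \<le> ?n" "int j \<le> K ?n" using t by auto
      have "K t < int (arr ?G t ?n (nat (K ?n)))" if "t \<in> {i..<?n}" for t
      proof -
        have "t \<in> {i..m}" using that by auto
        then have "K t < int j" using False by force
        then show ?thesis using ge[of t ?n] n that Suc.prems by auto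
      qed
      then show ?thesis using n by (intro bexI[of _ ?n]) auto
    next
      case True
      then obtain r where r: "r \<in> {i..m}" "int j \<le> K r"
        "\<And>t. t \<in> {i..<r} \<Longrightarrow> K t < int (arr ?G t r (nat (K r)))"
        "\<And>t. t \<in> {r<..m} \<Longrightarrow> int j \<le> K t \<Longrightarrow> arr ?G r t (nat (K t)) \<le> nat (K r)"
        using Suc by auto
      show ?thesis
      proof (cases "int j \<le> K ?n \<and> nat (K r) < arr ?G r ?n (nat (K ?n))")
        case False
        then show ?thesis using r by (intro bexI[of _ r]) (auto simp: le_Suc_eq)
      next
        case n: True
        have "K t < int (arr ?G t ?n (nat (K ?n)))" if t: "t \<in> {i..<?n}" for t
        proof -
          consider "t < r" | "t = r" | "r < t" "K t < int j" | "r < t" "int j \<le> K t" by linarith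
          then show ?thesis
          proof cases
            case 1
            have "K t < int (arr ?G t r (nat (K r)))" using r t 1 by auto
            also have "\<dots> \<le> int (arr ?G t r (arr ?G r ?n (nat (K ?n))))"
              using n by (intro of_nat_mono arr_mono) auto
            also have "\<dots> = int (arr ?G t ?n (nat (K ?n)))"
              using arr_comp[of t r ?n] 1 r by auto
            finally show ?thesis .
          next
            case 2
            then show ?thesis using n r by auto
          next
            case 3
            then show ?thesis using ge[of t ?n] n t Suc.prems r by auto
          next
            case 4
            show ?thesis
            proof (rule ccontr)
              assume "\<not> ?thesis"
              then have "arr ?G t ?n (nat (K ?n)) \<le> nat (K t)" by auto
              then have "arr ?G r t (arr ?G t ?n (nat (K ?n))) \<le> arr ?G r t (nat (K t))"
                by (rule arr_mono)
              also have "\<dots> \<le> nat (K r)" using r(4)[of t] 4 t by auto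
              finally show False using n arr_comp[of r t ?n ?G] 4 t by auto
            qed
          qed
        qed
        then show ?thesis using n r by (intro bexI[of _ ?n]) auto
      qed
    qed
  qed
  moreover have "int j \<le> K h" using hook_funsD[OF K, of h] i by auto
  ultimately have "\<exists>r\<in>{i..h}. int j \<le> K r \<and>
     (\<forall>t\<in>{i..<r}. K t < int (arr ?G t r (nat (K r)))) \<and>
     (\<forall>t\<in>{r<..h}. int j \<le> K t \<longrightarrow> arr ?G r t (nat (K t)) \<le> nat (K r))"
    using i by fastforce
  then show ?thesis by (auto simp: chosen_def)
qed

text \<open>The two conditions of \<open>chosen\<close> become the two criteria for backward paths
  before the slide: \<open>K (t - 1) + 1 \<le> e (t - 1)\<close> for the rows after \<open>i\<close>
  up to \<open>r\<close>, and arrival in row \<open>r\<close> not beyond \<open>K r\<close> for the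
  rows below.\<close>

lemma hook_down_admissible:
  assumes inc: "incr_on (R i j) S" and K: "K \<in> admissible h j i S" and ch: "chosen h j i S K r"
  defines "U \<equiv> unslide (ecol i j S r (nat (K r))) r S (i, j)"
  shows "hook_down i r K \<in> admissible h j (Suc i) U"
proof -
  let ?c = "nat (K r)" and ?G = "goN (R i j) S"
  let ?e = "ecol i j S r ?c"
  have Kh: "K \<in> hook_funs h j i" using K by (simp add: admissible_def)
  have r: "i \<le> r" "r \<le> h" "int j \<le> K r" using ch by (auto simp: chosen_def)
  have re: "reaches i j S r ?c" using K r by (auto simp: admissible_def)
  note ef = ecol_facts[OF i(1,2) re]
  have low: "K t < int (?e t)" if "i \<le> t" "t < r" for t
    using ch that by (auto simp: chosen_def ecol_def)
  have high: "arr ?G r t (nat (K t)) \<le> ?c" if "r < t" "t \<le> h" "int j \<le> K t" for t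
    using ch that by (auto simp: chosen_def)
  have hook: "hook_down i r K \<in> hook_funs h j (Suc i)"
    unfolding hook_funs_def
  proof (rule PiE_I)
    fix t assume t: "t \<in> {Suc i..h}"
    show "hook_down i r K t \<in> {k. int j - int (h - t) \<le> k \<and> (int j \<le> k \<longrightarrow> (t, nat k) \<in> D)}"
    proof (cases "t \<le> r")
      case True
      then obtain s where s: "t = Suc s" "i \<le> s" "s < r" using t by (cases t) auto
      have "(t, ?e t) \<in> D" using ef(7)[of t] tailD s True by auto
      moreover have "?e s \<le> ?e t" using ef(3)[of t] s True by auto
      moreover have "1 \<le> nat (K s + 1)" if "int j \<le> K s + 1" using that i by auto
      ultimately have "(t, nat (K s + 1)) \<in> D" if "int j \<le> K s + 1"
        using that low[OF s(2,3)] down[of t "?e t" t "nat (K s + 1)"] s by auto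
      moreover have "int j - int (h - s) \<le> K s" using hook_funsD[OF Kh, of s] s t by auto
      ultimately show ?thesis using s t True by (auto simp: hook_down_def of_nat_diff)
    next
      case False
      then show ?thesis using hook_funsD[OF Kh, of t] t by (auto simp: hook_down_def)
    qed
  next
    fix t assume t: "t \<notin> {Suc i..h}"
    have "t \<notin> {i..h} \<Longrightarrow> K t = undefined" using Kh by (auto simp: hook_funs_def PiE_def extensional_def)
    then show "hook_down i r K t = undefined" using t r by (auto simp: hook_down_def)
  qed
  moreover have "reaches (Suc i) j U t (nat (hook_down i r K t))"
    if t: "t \<in> {Suc i..h}" and c: "int j \<le> hook_down i r K t" for t
  proof -
    have "(t, nat (hook_down i r K t)) \<in> D" using hook_funsD(2)[OF hook, of t] t c by auto
    then have tR: "(t, nat (hook_down i r K t)) \<in> R (Suc i) j" using t c by (auto simp: tail_def)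
    show ?thesis
    proof (cases "t \<le> r")
      case True
      then obtain s where s: "t = Suc s" "i \<le> s" "s < r" using t by (cases t) auto
      have "nat (hook_down i r K t) \<le> ?e (t - 1)"
        using low[OF s(2,3)] s True by (auto simp: hook_down_def)
      then show ?thesis
        using unslide_reaches_within[OF i(1,2) re inc _ True tR] t by (auto simp: U_def)
    next
      case False
      then have "hook_down i r K t = K t" using t by (auto simp: hook_down_def)
      then show ?thesis
        using unslide_reaches_beyond[OF i(1,2) re inc _ tR] high[of t] t c False by (auto simp: U_def)
    qed
  qed
  ultimately show ?thesis by (auto simp: admissible_def)
qed

text \<open>The same two criteria are read in the other direction. They also place every candidate
  path weakly west of the path from \<open>(r, c)\<close> where it enters row \<open>i\<close>, so
  \<open>reaches_le\<close> applies.\<close>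

lemma hook_up_admissible:
  assumes inc: "incr_on (R i j) S" and re: "reaches i j S r c"
  defines "U \<equiv> unslide (ecol i j S r c) r S (i, j)"
  assumes K: "K \<in> admissible h j (Suc i) U"
  shows "hook_up i r c K \<in> admissible h j i S" "chosen h j i S (hook_up i r c K) r"
proof -
  let ?G = "goN (R i j) S" and ?e = "ecol i j S r c" and ?K = "hook_up i r c K"
  have Kh: "K \<in> hook_funs h j (Suc i)" using K by (simp add: admissible_def)
  have Kr: "reaches (Suc i) j U t (nat (K t))" if "i < t" "t \<le> h" "int j \<le> K t" for t
    using K that by (auto simp: admissible_def)
  have rc: "i \<le> r" "(r, c) \<in> D" "j \<le> c" using re by (auto simp: reaches_def tail_def)
  have rh: "r \<le> h" using height[of r] down[OF rc(2), of r j] pos[OF rc(2)] rc i by auto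
  note ef = ecol_facts[OF i(1,2) re]
  have KR: "(t, nat (K t)) \<in> R (Suc i) j" if "i < t" "t \<le> h" "int j \<le> K t" for t
    using that hook_funsD(2)[OF Kh, of t] by (auto simp: tail_def)
  have low: "?K t < int (?e t)" if t: "i \<le> t" "t < r" for t
  proof (cases "int j \<le> K (Suc t)")
    case True
    have "nat (K (Suc t)) \<le> ?e t"
      using unslide_reaches_within[OF i(1,2) re inc _ _ KR, of "Suc t"] Kr[of "Suc t"] True t rh
      by (auto simp: U_def)
    then show ?thesis using t by (auto simp: hook_up_def)
  next
    case False
    then show ?thesis using ef(4)[of t] t by (auto simp: hook_up_def)
  qed
  have high: "arr ?G r t (nat (?K t)) \<le> c" if t: "r < t" "t \<le> h" "int j \<le> ?K t" for t
  proof -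
    have "?K t = K t" using t by (auto simp: hook_up_def)
    then show ?thesis
      using unslide_reaches_beyond[OF i(1,2) re inc t(1) KR] Kr[of t] t rc by (auto simp: U_def)
  qed
  have hook: "?K \<in> hook_funs h j i"
    unfolding hook_funs_def
  proof (rule PiE_I)
    fix t assume t: "t \<in> {i..h}"
    show "?K t \<in> {k. int j - int (h - t) \<le> k \<and> (int j \<le> k \<longrightarrow> (t, nat k) \<in> D)}"
    proof (cases "t < r")
      case True
      then have "(t, nat (K (Suc t) - 1)) \<in> D" if "int j \<le> K (Suc t) - 1"
        using that hook_funsD(2)[OF Kh, of "Suc t"] down[of "Suc t" "nat (K (Suc t))" t "nat (K (Suc t) - 1)"]
          t i rh by auto
      then show ?thesis using hook_funsD(1)[OF Kh, of "Suc t"] True t rh by (auto simp: hook_up_def of_nat_diff)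
    next
      case False
      then show ?thesis using hook_funsD[OF Kh, of t] t rc by (cases "t = r") (auto simp: hook_up_def)
    qed
  next
    fix t assume t: "t \<notin> {i..h}"
    then have "K t = undefined" using Kh by (auto simp: hook_funs_def PiE_def extensional_def)
    then show "?K t = undefined" using t rc rh by (auto simp: hook_up_def)
  qed
  have Kr': "?K r = int c" by (simp add: hook_up_def)
  show "chosen h j i S ?K r"
    using rc rh low high by (auto simp: chosen_def Kr' ecol_def)
  have "reaches i j S t (nat (?K t))" if t: "t \<in> {i..h}" and c: "int j \<le> ?K t" for t
  proof -
    have tR: "(t, nat (?K t)) \<in> R i j" using hook_funsD(2)[OF hook, of t] t c by (auto simp: tail_def)
    have "arr ?G i t (nat (?K t)) \<le> arr ?G i r c"
    proof (cases "t \<le> r")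
      case True
      have "nat (?K t) \<le> ?e t" using low[of t] t True ef(2) Kr' by (cases "t = r") auto
      then have "arr ?G i t (nat (?K t)) \<le> arr ?G i t (arr ?G t r c)" using t by (auto simp: ecol_def intro: arr_mono)
      then show ?thesis using arr_comp[of i t r ?G c] True t by auto
    next
      case False
      then have "arr ?G i r (arr ?G r t (nat (?K t))) \<le> arr ?G i r c" using high[of t] t c by (auto intro: arr_mono)
      then show ?thesis using arr_comp[of i r t ?G] False rc by auto
    qed
    then show ?thesis using reaches_le[OF re tR] t by auto
  qed
  with hook show "?K \<in> admissible h j i S" by (auto simp: admissible_def)
qed

lemma hook_down_up:
  assumes "K \<in> hook_funs h j (Suc i)" "i \<le> r"
  shows "hook_down i r (hook_up i r c K) = K"
proof
  fix t
  have "K i = undefined" using assms by (auto simp: hook_funs_def PiE_def extensional_def)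
  then show "hook_down i r (hook_up i r c K) t = K t"
    using assms by (auto simp: hook_down_def hook_up_def)
qed

lemma hook_up_down:
  assumes "i \<le> r" "int j \<le> K r"
  shows "hook_up i r (nat (K r)) (hook_down i r K) = K"
  using assms by (auto simp: hook_down_def hook_up_def fun_eq_iff)

text \<open>An admissible \<open>K\<close> is sent to the tableau before the chosen slide, together
  with the remaining hook function. The entry in \<open>(i, j)\<close> before the slide reveals
  through its place in \<open>S\<close> where the slide ended, and then \<open>hook_up\<close>
  recovers \<open>K\<close>. Conversely, the end cell of any slide into \<open>S\<close> is the
  chosen one after \<open>hook_up\<close>.\<close>

lemma card_admissible_step:
  assumes inc: "incr_on (R i j) S" and inj: "inj_on S D"
  shows "card (admissible h j i S) = card (SIGMA U:slide_sources i j S. admissible h j (Suc i) U)"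
proof (rule bij_betw_same_card)
  define row where "row K = (THE r. chosen h j i S K r)" for K
  define U where "U r c = unslide (ecol i j S r c) r S (i, j)" for r c
  have row: "chosen h j i S K (row K)" if "K \<in> admissible h j i S" for K
    unfolding row_def
  proof (rule theI')
    show "\<exists>!r. chosen h j i S K r"
      using chosen_exists[of K S] chosen_unique that by (auto simp: admissible_def)
  qed
  have reK: "i \<le> row K" "int j \<le> K (row K)" "reaches i j S (row K) (nat (K (row K)))"
    if "K \<in> admissible h j i S" for K
    using row[OF that] that by (auto simp: chosen_def admissible_def)
  have ijD: "(i, j) \<in> D" using height i by auto
  have U: "U r c \<in> slide_sources i j S" "slides D (U r c) (i, j) S (r, c)" if re: "reaches i j S r c" for r c
  proof -
    note ef = ecol_facts[OF i(1,2) re]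
    have ir: "i \<le> r" using re by (simp add: reaches_def)
    note us = unslide_slides[OF i(1,2) re inc inj order.refl ir, of j, unfolded Let_def, folded U_def]
    have "ecol i j S r c (i - 1) \<le> j" "j \<le> ecol i j S r c i" using ef ir by auto
    note us = us[OF this]
    then show "U r c \<in> slide_sources i j S" using hole_incr_start[OF ijD] by (auto simp: slide_sources_def)
    show "slides D (U r c) (i, j) S (r, c)" using us by simp
  qed
  have Uij: "U r c (i, j) = S (r, c)" if "reaches i j S r c" for r c
    using ecol_end[OF i(1,2) that] by (simp add: U_def unslide_def)
  let ?f = "\<lambda>K. (U (row K) (nat (K (row K))), hook_down i (row K) K)"
  show "bij_betw ?f (admissible h j i S) (SIGMA U:slide_sources i j S. admissible h j (Suc i) U)"
    unfolding bij_betw_def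
  proof
    show "inj_on ?f (admissible h j i S)"
    proof (rule inj_onI)
      fix K K' assume K: "K \<in> admissible h j i S" and K': "K' \<in> admissible h j i S" and eq: "?f K = ?f K'"
      have D: "(row K, nat (K (row K))) \<in> D" "(row K', nat (K' (row K'))) \<in> D"
        using reK(3)[OF K] reK(3)[OF K'] tailD by (auto simp: reaches_def)
      have "S (row K, nat (K (row K))) = S (row K', nat (K' (row K')))"
        using Uij[OF reK(3)[OF K]] Uij[OF reK(3)[OF K']] eq by simp
      then have "(row K, nat (K (row K))) = (row K', nat (K' (row K')))"
        by (rule inj_onD[OF inj _ D])
      then show "K = K'" using hook_up_down[of "row K" K] hook_up_down[of "row K'" K'] reK[OF K] reK[OF K'] eq
        by (metis Pair_inject)
    qed
    show "?f ` admissible h j i S = (SIGMA U:slide_sources i j S. admissible h j (Suc i) U)"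
    proof (intro equalityI subsetI)
      fix p assume "p \<in> ?f ` admissible h j i S"
      then obtain K where K: "K \<in> admissible h j i S" "p = ?f K" by auto
      then show "p \<in> (SIGMA U:slide_sources i j S. admissible h j (Suc i) U)"
        using hook_down_admissible[OF inc K(1) row[OF K(1)]] U(1)[OF reK(3)[OF K(1)]] by (auto simp: U_def)
    next
      fix p assume "p \<in> (SIGMA U:slide_sources i j S. admissible h j (Suc i) U)"
      then obtain V K where p: "p = (V, K)" and V: "V \<in> slide_sources i j S" and K: "K \<in> admissible h j (Suc i) V" by auto
      obtain r c where sl: "slides D V (i, j) S (r, c)" using V by (auto simp: slide_sources_def)
      have V': "incr_on (R (Suc i) j) V" "inj_on V D" using V by (auto simp: slide_sources_def)
      note sr = slide_reaches[OF ijD V' sl]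
      have VU: "V = U r c" using sr(2) by (simp add: U_def)
      let ?K = "hook_up i r c K"
      have ir: "i \<le> r" using sr(1) by (simp add: reaches_def)
      have up: "?K \<in> admissible h j i S" "chosen h j i S ?K r"
        using hook_up_admissible[OF inc sr(1), of K] K VU by (auto simp: U_def)
      have "row ?K = r" using chosen_unique row up by blast
      moreover have "?K r = int c" by (simp add: hook_up_def)
      moreover have "hook_down i r ?K = K" using K ir by (intro hook_down_up) (auto simp: admissible_def)
      ultimately have "p = ?f ?K" using p VU by simp
      then show "p \<in> ?f ` admissible h j i S" using up by blast
    qed
  qed
qed

end

text \<open>There is no row above row 1, so backward paths that come to it can only run west, into
  \<open>(1, j)\<close>.\<close>

lemma admissible_top:
  assumes "1 \<le> j"
  shows "admissible h j 1 S = hook_funs h j 1"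
proof -
  have "\<not> goN (R 1 j) S 1 d" for d
    using pos[of 0 d] by (auto simp: goN_def tail_def)
  then have "reaches 1 j S t b" if "(t, b) \<in> D" "j \<le> b" for t b
    using that pos[of t b] by (auto simp: reaches_def tail_def)
  then show ?thesis using hook_funsD by (fastforce simp: admissible_def)
qed

lemma admissible_bottom: "admissible h j (Suc h) S = {\<lambda>_. undefined}"
  by (auto simp: admissible_def hook_funs_def)

lemma slides_image:
  assumes "slides D V q W x" "q \<in> D"
  shows "W ` D = V ` D \<and> (\<forall>u. u \<notin> D \<longrightarrow> W u = V u)"
  using assms
proof induction
  case (step V q y W x)
  then have y: "y \<in> D" by (auto simp: exch_def)
  have "swap_cells V q y u = V u" if "u \<notin> D" for u
    using that y step.prems by (metis swap_cells_simps(3))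
  then show ?case using step y image_swap_cells[of q D y V] by simp
qed simp

definition height :: "nat \<Rightarrow> nat" where
  "height j = card {a. (a, j) \<in> D}"

lemma height: "(a, j) \<in> D \<longleftrightarrow> 1 \<le> a \<and> a \<le> height j"
proof -
  let ?A = "{a. (a, j) \<in> D}"
  have f: "finite ?A" using finite_surj[OF fin, of ?A fst] by force
  show ?thesis
  proof (cases "?A = {}")
    case True
    then show ?thesis by (auto simp: height_def)
  next
    case False
    define M where "M = Max ?A"
    have A: "?A = {1..M}" unfolding M_def
    proof (intro equalityI subsetI)
      fix a assume "a \<in> {1..Max ?A}"
      moreover have "Max ?A \<in> ?A" using f False by (rule Max_in)
      ultimately show "a \<in> ?A" using down[of "Max ?A" j a j] pos[of "Max ?A" j] by auto
    qed (use pos f in auto)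
    have "height j = M" unfolding height_def A by simp
    with A have "?A = {1..height j}" by simp
    then show ?thesis by auto
  qed
qed

lemma tail_1_1: "R 1 1 = D"
proof -
  have "1 < b \<or> b = 1 \<and> 1 \<le> a" if "(a, b) \<in> D" for a b using pos[OF that] by linarith
  then show ?thesis by (auto simp: tail_def)
qed

lemma adjacent_incr_on:
  assumes "\<And>u w. u \<in> D \<Longrightarrow> w \<in> D \<Longrightarrow> w \<in> nbrs u \<Longrightarrow> V u < V w"
  shows "incr_on D V"
proof -
  have "V u < V w" if "u \<in> D" "w \<in> D" "cle u w" "u \<noteq> w" for u w
    using that
  proof (induction "fst w + snd w" arbitrary: w rule: less_induct)
    case less
    then obtain y where y: "y \<in> D" "w \<in> nbrs y" "cle u y"
      using tail_nbr_below[of u 1 1 w] unfolding tail_1_1 by metis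
    have yw: "V y < V w" using assms y less.prems by auto
    show ?case
    proof (cases "u = y")
      case False
      have "fst y + snd y < fst w + snd w" using y(2) by (auto simp: nbrs_def)
      with less.hyps[OF this less.prems(1) y(1,3) False] yw show ?thesis by simp
    qed (use yw in simp)
  qed
  then show ?thesis by (auto simp: incr_on_def)
qed

end

section \<open>Uniformity of sorting\<close>

lemma card_UN_fibres:
  assumes "finite A" "finite B"
  shows "card (\<Union>y\<in>A. {x \<in> B. f x = y}) = (\<Sum>y\<in>A. card {x \<in> B. f x = y})"
  using assms by (intro card_UN_disjoint) auto

section \<open>Sorting stages for a partition shape\<close>

locale partition_shape =
  fixes lam :: "nat list" and n :: nat
  assumes part: "is_partition lam n"
begin

abbreviation "D \<equiv> diagram lam"
abbreviation "tabs \<equiv> tabloids lam"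
abbreviation "cell m \<equiv> z lam m"
abbreviation "stage T m \<equiv> Tz lam T m"

lemma size: "sum_list lam = n" and sorted_lam: "sorted (rev lam)"
  using part by (auto simp: is_partition_def)

lemma diagram_Sigma: "D = (SIGMA i:{1..length lam}. {1..lam ! (i - 1)})"
  by (auto simp: diagram_def)

sublocale young D
proof
  show "finite D" by (auto simp: diagram_Sigma)
  show "1 \<le> a \<and> 1 \<le> b" if "(a, b) \<in> D" for a b using that by (auto simp: diagram_def)
  show "(a', b') \<in> D" if "(a, b) \<in> D" "1 \<le> a'" "a' \<le> a" "1 \<le> b'" "b' \<le> b" for a b a' b'
  proof -
    have "lam ! (a - 1) \<le> lam ! (a' - 1)"
      using that by (intro sorted_rev_nth_mono sorted_lam) (auto simp: diagram_def)
    then show ?thesis using that by (auto simp: diagram_def)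
  qed
qed

lemma card_diagram: "card D = n"
proof -
  have "card D = (\<Sum>i\<in>{1..length lam}. lam ! (i - 1))" by (simp add: diagram_Sigma)
  also have "\<dots> = (\<Sum>i = 0..<length lam. lam ! i)"
    by (rule sum.reindex_bij_witness[of _ Suc "\<lambda>i. i - 1"]) auto
  finally show ?thesis using size by (simp add: sum_list_sum_nth)
qed

definition colmajor :: "cell list" where
  "colmajor = sorted_list_of_set ((\<lambda>(i, j). (j, i)) ` D)"

lemma cell_bij: "bij_betw cell {1..n} D"
  and cell_less: "1 \<le> m \<Longrightarrow> m < m' \<Longrightarrow> m' \<le> n \<Longrightarrow>
      snd (cell m) < snd (cell m') \<or> snd (cell m) = snd (cell m') \<and> fst (cell m) < fst (cell m')"
proof -
  have inj: "inj_on (\<lambda>(i, j). (j, i)) A" for A :: "cell set" by (auto simp: inj_on_def)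
  have set: "set colmajor = (\<lambda>(i, j). (j, i)) ` D" using fin by (simp add: colmajor_def)
  have len: "length colmajor = n" using fin card_diagram by (simp add: colmajor_def card_image[OF inj])
  have cell: "cell m = prod.swap (colmajor ! (m - 1))" if "1 \<le> m" "m \<le> n" for m
    using that len by (simp add: z_def cell_list_def colmajor_def case_prod_beta prod.swap_def)
  have "bij_betw (\<lambda>m. colmajor ! m) {..<n} (set colmajor)"
    using len by (intro bij_betw_nth) (auto simp: colmajor_def)
  moreover have "bij_betw (\<lambda>m. m - 1) {1..n} {..<n}"
    by (rule bij_betw_byWitness[where f' = Suc]) auto
  moreover have "bij_betw prod.swap (set colmajor) D"
    unfolding set by (rule bij_betw_byWitness[where f' = prod.swap]) (auto simp: image_iff)
  ultimately have "bij_betw (prod.swap \<circ> (\<lambda>m. colmajor ! m) \<circ> (\<lambda>m. m - 1)) {1..n} D"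
    by (blast intro: bij_betw_trans)
  then show "bij_betw cell {1..n} D"
    by (rule bij_betw_cong[THEN iffD1, rotated]) (simp add: cell)
  show "snd (cell m) < snd (cell m') \<or> snd (cell m) = snd (cell m') \<and> fst (cell m) < fst (cell m')"
    if "1 \<le> m" "m < m'" "m' \<le> n"
  proof -
    have "sorted_wrt (<) colmajor" by (simp add: colmajor_def)
    then have "colmajor ! (m - 1) < colmajor ! (m' - 1)"
      using that len by (intro sorted_wrt_nth_less[of "(<)" colmajor]) auto
    then show ?thesis using cell[of m] cell[of m'] that by (auto simp: less_prod_def)
  qed
qed

lemma cellD: "1 \<le> m \<Longrightarrow> m \<le> n \<Longrightarrow> cell m \<in> D"
  using bij_betwE[OF cell_bij] by auto

lemma cell_tail:
  assumes m: "1 \<le> m" "m \<le> n" "cell m = (i, j)"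
  shows "cell ` {m..n} = R i j" "cell ` {Suc m..n} = R (Suc i) j"
proof -
  have D: "u \<in> D \<longleftrightarrow> (\<exists>m'\<in>{1..n}. u = cell m')" for u
    using cell_bij by (auto simp: bij_betw_def)
  have "(cell m' \<in> R i j \<longleftrightarrow> m \<le> m') \<and> (cell m' \<in> R (Suc i) j \<longleftrightarrow> m < m')" if m': "m' \<in> {1..n}" for m'
  proof -
    have D': "cell m' \<in> D" "(i, j) \<in> D" using m' m cellD[of m] cellD[of m'] by auto
    consider "m' < m" | "m' = m" | "m < m'" by linarith
    then show ?thesis
    proof cases
      case 1
      then show ?thesis using cell_less[of m' m] m m' D' by (cases "cell m'") (auto simp: tail_def)
    next
      case 2
      then show ?thesis using m D' by (auto simp: tail_def)
    next
      case 3
      then show ?thesis using cell_less[of m m'] m m' D' by (cases "cell m'") (auto simp: tail_def)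
    qed
  qed
  note * = this
  show "cell ` {m..n} = R i j"
  proof (intro equalityI subsetI)
    fix u assume "u \<in> R i j"
    then obtain m' where "m' \<in> {1..n}" "u = cell m'" using D tailD by blast
    then show "u \<in> cell ` {m..n}" using *[of m'] \<open>u \<in> R i j\<close> by auto
  qed (use * m in auto)
  show "cell ` {Suc m..n} = R (Suc i) j"
  proof (intro equalityI subsetI)
    fix u assume "u \<in> R (Suc i) j"
    then obtain m' where "m' \<in> {1..n}" "u = cell m'" using D tailD by blast
    then show "u \<in> cell ` {Suc m..n}" using *[of m'] \<open>u \<in> R (Suc i) j\<close> by auto
  qed (use * m in auto)
qed

lemma tabs_iff: "T \<in> tabs \<longleftrightarrow> inj_on T D \<and> T ` D = {1..n} \<and> (\<forall>u. u \<notin> D \<longrightarrow> T u = 0)"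
  by (auto simp: tabloids_def bij_betw_def size)

lemma tabs_range: "T \<in> tabs \<Longrightarrow> u \<in> D \<Longrightarrow> T u \<in> {1..n}"
  using tabs_iff imageI by blast

lemma tabs_outside: "T \<in> tabs \<Longrightarrow> u \<notin> D \<Longrightarrow> T u = 0"
  using tabs_iff by blast

lemma finite_tabs: "finite tabs"
proof (rule finite_subset)
  show "tabs \<subseteq> {f. \<forall>x. (x \<in> D \<longrightarrow> f x \<in> {1..n}) \<and> (x \<notin> D \<longrightarrow> f x = 0)}"
    using tabs_range tabs_iff by blast
qed (intro finite_set_of_finite_funs fin finite_atLeastAtMost)

lemma slide_slides:
  assumes "V \<in> tabs" "q \<in> D"
  obtains x where "slides D V q (slide lam V q) x"
    "\<And>w. w \<in> D \<inter> nbrs x \<Longrightarrow> slide lam V q x \<le> slide lam V q w"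
proof -
  have "card {u \<in> D. cle q u} \<le> card D" using fin by (intro card_mono) auto
  then show thesis
    using slide_fuel_slides[OF fin assms(2), of n V] that by (auto simp: slide_def size card_diagram)
qed

lemma slide_tabs:
  assumes "V \<in> tabs" "q \<in> D"
  shows "slide lam V q \<in> tabs"
proof -
  obtain x where x: "slides D V q (slide lam V q) x" using slide_slides assms by blast
  show ?thesis using slides_inj_on(1)[OF x] slides_image[OF x] assms by (simp add: tabs_iff)
qed

lemma slide_incr:
  assumes V: "V \<in> tabs" and ij: "(i, j) \<in> D" and inc: "incr_on (R (Suc i) j) V"
  shows "incr_on (R i j) (slide lam V (i, j))"
proof -
  obtain x where x: "slides D V (i, j) (slide lam V (i, j)) x"
    "\<And>w. w \<in> D \<inter> nbrs x \<Longrightarrow> slide lam V (i, j) x \<le> slide lam V (i, j) w"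
    using slide_slides[OF V ij] by blast
  have "hole_incr (R i j) (slide lam V (i, j)) x"
    using slides_hole_incr[OF x(1)] hole_incr_start[OF ij] inc V by (auto simp: tabs_iff)
  then show ?thesis using hole_incr_terminal x(2) slide_tabs[OF V ij] by (auto simp: tabs_iff)
qed

text \<open>As \<open>S\<close> increases on the tail, a partial run that arrives at
  \<open>S\<close> cannot go on, so it is the complete slide.\<close>

lemma slide_sources_eq:
  assumes S: "S \<in> tabs" and ij: "(i, j) \<in> D" and inc: "incr_on (R i j) S"
  shows "slide_sources i j S = {U \<in> tabs. incr_on (R (Suc i) j) U \<and> slide lam U (i, j) = S}"
proof (intro equalityI subsetI)
  fix U assume U: "U \<in> slide_sources i j S"
  then have Ut: "U \<in> tabs" and Ui: "incr_on (R (Suc i) j) U" using S by (auto simp: slide_sources_def tabs_iff)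
  obtain x where x: "slides D U (i, j) S x" using U by (auto simp: slide_sources_def)
  have Uinj: "inj_on U D" using Ut by (simp add: tabs_iff)
  have "hole_incr (R i j) S x" using slides_hole_incr[OF x _ Uinj] hole_incr_start[OF ij] Ui by simp
  then have xR: "x \<in> R i j" by (simp add: hole_incr_def)
  have tx: "S x \<le> S w" if w: "w \<in> D \<inter> nbrs x" for w
  proof -
    have c: "cle x w" "x \<noteq> w" using w cle_nbrs by blast+
    then have "w \<in> R i j" using tail_up[OF xR] w by auto
    then show ?thesis using incr_onD[OF inc xR _ c] by simp
  qed
  obtain x' where x': "slides D U (i, j) (slide lam U (i, j)) x'"
    "\<And>w. w \<in> D \<inter> nbrs x' \<Longrightarrow> slide lam U (i, j) x' \<le> slide lam U (i, j) w"
    using slide_slides[OF Ut ij] by blast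
  have "slide lam U (i, j) = S" using slides_unique[OF x'(1,2) x tx Uinj ij] .
  then show "U \<in> {U \<in> tabs. incr_on (R (Suc i) j) U \<and> slide lam U (i, j) = S}" using Ut Ui by simp
next
  fix U assume U: "U \<in> {U \<in> tabs. incr_on (R (Suc i) j) U \<and> slide lam U (i, j) = S}"
  then have Ut: "U \<in> tabs" and eq: "slide lam U (i, j) = S" by auto
  obtain x where "slides D U (i, j) S x" using slide_slides[OF Ut ij] unfolding eq by blast
  then show "U \<in> slide_sources i j S" using U S by (auto simp: slide_sources_def tabs_iff simp del: split_paired_Ex)
qed

lemma stage_Suc_n: "stage T (Suc n) = T"
  by (simp add: Tz_def size)

text \<open>The last cell has no right or bottom neighbour. An additional slide there is harmless,
  and with \<open>stage T (Suc n) = T\<close> the recursion has the same form for all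
  \<open>m \<le> n\<close>.\<close>

lemma slide_last:
  assumes "1 \<le> n"
  shows "slide lam V (cell n) = V"
proof -
  obtain i j where ij: "cell n = (i, j)" by (cases "cell n")
  have D: "(i, j) \<in> D" using cellD[of n] assms ij by simp
  have "R (Suc i) j = {}" using cell_tail(2)[of n i j] assms ij by simp
  moreover have "w \<in> R (Suc i) j" if "w \<in> D \<inter> nbrs (i, j)" for w
  proof -
    have c: "cle (i, j) w" "w \<noteq> (i, j)" using that cle_nbrs by blast+
    then have "w \<in> R i j" using that tail_up[of "(i, j)" i j w] D by (auto simp: tail_def)
    then show ?thesis using tail_Suc[OF D] c by auto
  qed
  ultimately have no: "D \<inter> nbrs (i, j) = {}" by blast
  have "slide_fuel D V (i, j) f = V" for f
  proof (cases f)
    case (Suc f')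
    show ?thesis unfolding Suc
      by (cases rule: slide_fuel_Suc_cases[of D V "(i, j)" f']) (use no in \<open>auto simp: exch_def\<close>)
  qed simp
  then show ?thesis by (simp add: slide_def ij)
qed

lemma stage_step:
  assumes "1 \<le> m" "m \<le> n"
  shows "stage T m = slide lam (stage T (Suc m)) (cell m)"
proof (cases "m = n")
  case True
  then show ?thesis using slide_last assms by (simp add: stage_Suc_n) (simp add: Tz_def size)
next
  case False
  then have "n - m = Suc (n - Suc m)" "n - Suc (n - Suc m) = m" using assms by auto
  then show ?thesis by (simp add: Tz_def size)
qed

lemma stage_tabs:
  assumes "T \<in> tabs" "1 \<le> m" "m \<le> Suc n"
  shows "stage T m \<in> tabs"
  using assms(3,2)
proof (induction m rule: inc_induct)
  case base
  then show ?case using assms by (simp add: stage_Suc_n)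
next
  case (step m)
  then show ?case using stage_step[of m T] slide_tabs cellD by auto
qed

lemma stage_incr:
  assumes "T \<in> tabs" "1 \<le> m" "m \<le> Suc n"
  shows "incr_on (cell ` {m..n}) (stage T m)"
  using assms(3,2)
proof (induction m rule: inc_induct)
  case base
  then show ?case by (simp add: incr_on_def)
next
  case (step m)
  then have m: "1 \<le> m" "m \<le> n" by auto
  obtain i j where ij: "cell m = (i, j)" by (cases "cell m")
  show ?case
    using slide_incr[of "stage T (Suc m)" i j] stage_tabs[OF assms(1)] step cellD[OF m] cell_tail[OF m ij]
      stage_step[OF m] ij by auto
qed

lemma stage_unprocessed:
  assumes "1 \<le> m" "m < m'" "m' \<le> Suc n"
  shows "stage T m' (cell m) = T (cell m)"
  using assms(3,2)
proof (induction m' rule: inc_induct)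
  case base
  then show ?case by (simp add: stage_Suc_n)
next
  case (step k)
  then have k: "1 \<le> k" "k \<le> n" using assms by auto
  have "\<not> cle (cell k) (cell m)" using cell_less[of m k] step assms by (auto simp: cle_def)
  then show ?case using stage_step[OF k, of T] slide_fuel_unaffected step by (simp add: slide_def)
qed

text \<open>The induction step for the count: tabloids are grouped by the tableau just before the
  slide at \<open>cell m\<close>, and \<open>card_admissible_step\<close> adds up the
  groups.\<close>

lemma card_sources:
  assumes S: "S \<in> tabs" and m: "1 \<le> m" "m \<le> n" "cell m = (i, j)" and inc: "incr_on (R i j) S"
    and C: "\<And>U. U \<in> tabs \<Longrightarrow> incr_on (R (Suc i) j) U \<Longrightarrow>
      card {T \<in> tabs. stage T (Suc m) = U} = C * card (admissible (height j) j (Suc i) U)"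
  shows "card {T \<in> tabs. stage T m = S} = C * card (admissible (height j) j i S)"
proof -
  let ?src = "slide_sources i j S"
  have ijD: "(i, j) \<in> D" using cellD m by metis
  have ij: "1 \<le> i" "1 \<le> j" "i \<le> height j" using pos[OF ijD] height[of i j] ijD by auto
  have src: "?src = {U \<in> tabs. incr_on (R (Suc i) j) U \<and> slide lam U (i, j) = S}"
    using slide_sources_eq[OF S ijD inc] .
  have fin_src: "finite ?src" using finite_tabs by (simp add: src)
  have "{T \<in> tabs. stage T m = S} = (\<Union>U\<in>?src. {T \<in> tabs. stage T (Suc m) = U})"
    using stage_tabs[of _ "Suc m"] stage_incr[of _ "Suc m"] cell_tail(2)[OF m] stage_step[OF m(1,2)] m
    by (auto simp: src)
  then have "card {T \<in> tabs. stage T m = S} = (\<Sum>U\<in>?src. card {T \<in> tabs. stage T (Suc m) = U})"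
    using card_UN_fibres[OF fin_src finite_tabs] by simp
  also have "\<dots> = (\<Sum>U\<in>?src. C * card (admissible (height j) j (Suc i) U))"
    using C by (intro sum.cong) (auto simp: src)
  also have "\<dots> = C * card (SIGMA U:?src. admissible (height j) j (Suc i) U)"
    using fin_src finite_admissible by (simp add: sum_distrib_left)
  also have "\<dots> = C * card (admissible (height j) j i S)"
    using card_admissible_step[OF ij height inc] S by (simp add: tabs_iff)
  finally show ?thesis .
qed

text \<open>The constant depends on \<open>m\<close> but not on \<open>S\<close>. When a column is
  finished, all its hook functions are admissible, so their number no longer depends on the tableau
  and can be absorbed into \<open>C\<close>; the column to its left then starts with the empty hook
  function alone.\<close>

lemma card_stage:
  assumes "1 \<le> m" "m \<le> n"
  shows "\<exists>C. \<forall>i j. cell m = (i, j) \<longrightarrow> (\<forall>S\<in>tabs. incr_on (R i j) S \<longrightarrow>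
    card {T \<in> tabs. stage T m = S} = C * card (admissible (height j) j i S))"
  using assms(2,1)
proof (induction m rule: inc_induct)
  case base
  obtain i j where ij: "cell n = (i, j)" by (cases "cell n")
  have ijD: "(i, j) \<in> D" using cellD[of n] base ij by simp
  have em: "R (Suc i) j = {}" using cell_tail(2)[of n i j] base ij by simp
  have "(Suc i, j) \<notin> D" using em by (auto simp: tail_def)
  then have h: "height j = i" using height[of i j] height[of "Suc i" j] ijD by auto
  have "card {T \<in> tabs. stage T (Suc n) = U} = 1 * card (admissible (height j) j (Suc i) U)"
    if "U \<in> tabs" for U
  proof -
    have "{T \<in> tabs. stage T (Suc n) = U} = {U}" using that by (auto simp: stage_Suc_n)
    then show ?thesis by (simp add: h admissible_bottom)
  qed
  then show ?case using card_sources[of _ n i j 1] base ij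
    by (intro exI[of _ 1]) auto
next
  case (step m)
  then have m: "1 \<le> m" "m \<le> n" "Suc m \<le> n" by auto
  obtain i j where ij: "cell m = (i, j)" by (cases "cell m")
  obtain i' j' where ij': "cell (Suc m) = (i', j')" by (cases "cell (Suc m)")
  have ijD: "(i, j) \<in> D" "(i', j') \<in> D" using cellD[of m] cellD[of "Suc m"] m ij ij' by auto
  have R': "R i' j' = R (Suc i) j" using cell_tail(1)[OF _ m(3) ij'] cell_tail(2)[OF m(1,2) ij] by simp
  obtain C where C: "\<And>S. S \<in> tabs \<Longrightarrow> incr_on (R i' j') S \<Longrightarrow>
    card {T \<in> tabs. stage T (Suc m) = S} = C * card (admissible (height j') j' i' S)"
    using step.IH ij' by auto
  have mem: "(i', j') \<in> R (Suc i) j" using R' ijD(2) by (auto simp: tail_def)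
  have "\<exists>C'. \<forall>U\<in>tabs. incr_on (R (Suc i) j) U \<longrightarrow>
     card {T \<in> tabs. stage T (Suc m) = U} = C' * card (admissible (height j) j (Suc i) U)"
  proof (cases "(Suc i, j) \<in> D")
    case True
    then have "(Suc i, j) \<in> R i' j'" unfolding R' by (auto simp: tail_def)
    with mem have "i' = Suc i" "j' = j" by (auto simp: tail_def)
    then show ?thesis using C by blast
  next
    case False
    then have h: "height j = i" using height[of i j] height[of "Suc i" j] ijD by auto
    \<comment> \<open>A cell above \<open>(i', j')\<close> would belong to the tail after
      \<open>(i, j)\<close>, whose first cell is \<open>(i', j')\<close>.\<close>
    have "i' = 1"
    proof (rule ccontr)
      assume "i' \<noteq> 1"
      then have D: "(i' - 1, j') \<in> D" using ijD(2) down[of i' j' "i' - 1" j'] pos[of i' j'] by auto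
      show False
      proof (cases "j' = j")
        case True
        then show ?thesis using mem height[of i' j] h by (auto simp: tail_def)
      next
        case False
        then have "(i' - 1, j') \<in> R (Suc i) j" using mem D by (auto simp: tail_def)
        then have "(i' - 1, j') \<in> R i' j'" unfolding R' .
        then show False using \<open>i' \<noteq> 1\<close> pos[OF ijD(2)] by (auto simp: tail_def)
      qed
    qed
    then have "admissible (height j') j' i' U = hook_funs (height j') j' 1" for U
      using admissible_top pos[OF ijD(2)] by simp
    then show ?thesis using C R' h admissible_bottom
      by (intro exI[of _ "C * card (hook_funs (height j') j' 1)"]) auto
  qed
  then obtain C' where "\<And>U. U \<in> tabs \<Longrightarrow> incr_on (R (Suc i) j) U \<Longrightarrow>
     card {T \<in> tabs. stage T (Suc m) = U} = C' * card (admissible (height j) j (Suc i) U)" by blast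
  then show ?case using card_sources[OF _ m(1,2) ij, of _ C'] ij by auto
qed

lemma standard_iff: "standard lam S \<longleftrightarrow> S \<in> tabs \<and> incr_on D S"
proof
  assume S: "standard lam S"
  have "incr_on D S"
  proof (rule adjacent_incr_on)
    fix u w assume "u \<in> D" "w \<in> D" "w \<in> nbrs u"
    then show "S u < S w" using S by (cases u) (auto simp: standard_def nbrs_def)
  qed
  then show "S \<in> tabs \<and> incr_on D S" using S by (simp add: standard_def)
next
  assume "S \<in> tabs \<and> incr_on D S"
  then show "standard lam S" by (auto simp: standard_def incr_on_def cle_def)
qed

text \<open>The theorem of Novelli, Pak and Stoyanovskii, without the value of \<open>C\<close> (the product of the hook lengths).\<close>

lemma card_sorted_to:
  assumes "1 \<le> n"
  obtains C where "\<And>S. standard lam S \<Longrightarrow> card {T \<in> tabs. stage T 1 = S} = C"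
proof -
  obtain i j where ij: "cell 1 = (i, j)" by (cases "cell 1")
  have "R i j = D" using cell_tail(1)[of 1 i j] assms ij cell_bij by (simp add: bij_betw_def)
  moreover have ijD: "(i, j) \<in> D" using cellD[of 1] assms ij by simp
  then have "(1, 1) \<in> D" using pos down[of i j 1 1] by auto
  ultimately have "(1, 1) \<in> R i j" by simp
  then have ij1: "i = 1" "j = 1" using pos[OF ijD] by (auto simp: tail_def)
  obtain C where "\<And>S. S \<in> tabs \<Longrightarrow> incr_on (R 1 1) S \<Longrightarrow>
    card {T \<in> tabs. stage T 1 = S} = C * card (admissible (height 1) 1 1 S)"
    using card_stage[of 1] assms ij ij1 by auto
  then show thesis
    using that[of "C * card (hook_funs (height 1) 1 1)"] admissible_top[of 1 "height 1"] standard_iff tail_1_1 by auto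
qed

lemma stage_1_standard: "1 \<le> n \<Longrightarrow> T \<in> tabs \<Longrightarrow> standard lam (stage T 1)"
  using stage_tabs[of T 1] stage_incr[of T 1] cell_bij by (simp add: standard_iff bij_betw_def)

lemma finite_standard: "finite {S. standard lam S \<and> P S}"
  using finite_tabs by (rule rev_finite_subset) (auto simp: standard_iff)

lemma card_sorted:
  assumes "1 \<le> n"
  obtains C where "\<And>P. card {T \<in> tabs. P (stage T 1)} = C * card {S. standard lam S \<and> P S}"
proof -
  obtain C where C: "\<And>S. standard lam S \<Longrightarrow> card {T \<in> tabs. stage T 1 = S} = C"
    using card_sorted_to assms by blast
  have "card {T \<in> tabs. P (stage T 1)} = C * card {S. standard lam S \<and> P S}" for P
  proof -
    have "{T \<in> tabs. P (stage T 1)} = (\<Union>S\<in>{S. standard lam S \<and> P S}. {T \<in> tabs. stage T 1 = S})"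
      using stage_1_standard assms by auto
    then have "card {T \<in> tabs. P (stage T 1)} = (\<Sum>S\<in>{S. standard lam S \<and> P S}. card {T \<in> tabs. stage T 1 = S})"
      using card_UN_fibres[OF finite_standard finite_tabs] by simp
    then show ?thesis using C by simp
  qed
  then show thesis using that by blast
qed

section \<open>Counting tabloids\<close>

lemma permutes_tabs:
  assumes "p permutes {1..n}"
  shows "bij_betw (\<lambda>T u. p (T u)) tabs tabs"
proof -
  have *: "(\<lambda>u. p (T u)) \<in> tabs" if "p permutes {1..n}" "T \<in> tabs" for p T
  proof -
    have "inj_on (p \<circ> T) D" using that permutes_inj_on by (intro comp_inj_on) (auto simp: tabs_iff)
    moreover have "(p \<circ> T) ` D = {1..n}" using that permutes_image[of p "{1..n}"] by (simp only: image_comp[symmetric] tabs_iff)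
    moreover have "p 0 = 0" using permutes_not_in[OF that(1), of 0] by simp
    ultimately show ?thesis using that by (simp add: tabs_iff comp_def)
  qed
  show ?thesis
  proof (rule bij_betw_byWitness[where f' = "\<lambda>T u. inv p (T u)"])
    show "\<forall>T\<in>tabs. (\<lambda>u. inv p (p (T u))) = T" "\<forall>T\<in>tabs. (\<lambda>u. p (inv p (T u))) = T"
      using permutes_inverses[OF assms] by auto
  qed (use * assms permutes_inv in auto)
qed

lemma card_tabs: "card tabs = fact n"
proof -
  obtain T0 where T0: "T0 \<in> tabs"
  proof
    show "(\<lambda>u. if u \<in> D then inv_into {1..n} cell u else 0) \<in> tabs"
      using bij_betw_inv_into[OF cell_bij] by (auto simp: tabs_iff bij_betw_def inj_on_def image_iff cong: if_cong)
  qed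
  have "bij_betw (\<lambda>p u. p (T0 u)) {p. p permutes {1..n}} tabs"
    unfolding bij_betw_def
  proof
    have im: "T0 ` D = {1..n}" using T0 by (simp add: tabs_iff)
    show "inj_on (\<lambda>p u. p (T0 u)) {p. p permutes {1..n}}"
    proof (rule inj_onI)
      fix p p' assume p: "p \<in> {p. p permutes {1..n}}" "p' \<in> {p. p permutes {1..n}}"
        and eq: "(\<lambda>u. p (T0 u)) = (\<lambda>u. p' (T0 u))"
      show "p = p'"
      proof
        fix k
        show "p k = p' k"
        proof (cases "k \<in> {1..n}")
          case True
          then obtain u where "k = T0 u" using im by blast
          then show ?thesis using eq by metis
        qed (use p permutes_not_in in \<open>metis mem_Collect_eq\<close>)
      qed
    qed
    show "(\<lambda>p u. p (T0 u)) ` {p. p permutes {1..n}} = tabs"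
    proof (intro equalityI subsetI)
      fix T assume "T \<in> (\<lambda>p u. p (T0 u)) ` {p. p permutes {1..n}}"
      then show "T \<in> tabs" using permutes_tabs T0 bij_betwE by blast
    next
      fix T assume T: "T \<in> tabs"
      define p where "p k = (if k \<in> {1..n} then T (inv_into D T0 k) else k)" for k
      have "bij_betw (T \<circ> inv_into D T0) {1..n} {1..n}"
        using T T0 by (intro bij_betw_trans[OF bij_betw_inv_into]) (auto simp: tabs_iff bij_betw_def)
      then have "bij_betw p {1..n} {1..n}"
        by (rule bij_betw_cong[THEN iffD1, rotated]) (simp add: p_def)
      then have "p permutes {1..n}" by (rule bij_imp_permutes) (simp only: p_def if_False)
      moreover have "T = (\<lambda>u. p (T0 u))"
      proof
        fix u
        show "T u = p (T0 u)"
        proof (cases "u \<in> D")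
          case True
          then have "inv_into D T0 (T0 u) = u" using T0 by (simp add: tabs_iff)
          then show ?thesis using tabs_range[OF T0 True] by (simp only: p_def if_True)
        next
          case False
          then show ?thesis using tabs_outside[OF T] tabs_outside[OF T0] by (simp add: p_def)
        qed
      qed
      ultimately show "T \<in> (\<lambda>p u. p (T0 u)) ` {p. p permutes {1..n}}" by blast
    qed
  qed
  then have "card tabs = card {p. p permutes {1..n}}" by (simp add: bij_betw_same_card)
  then show ?thesis by (simp add: card_permutations)
qed

lemma card_tabs_at:
  assumes x: "x \<in> D" and k: "1 \<le> k" "k \<le> n"
  shows "card {T \<in> tabs. T x = k} = fact (n - 1)"
proof -
  have same: "card {T \<in> tabs. T x = k'} = card {T \<in> tabs. T x = k}" if k': "k' \<in> {1..n}" for k'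
  proof (rule bij_betw_same_card)
    have "transpose k k' permutes {1..n}" using k k' by (intro permutes_swap_id) auto
    from permutes_tabs[OF this]
    show "bij_betw (\<lambda>T u. transpose k k' (T u)) {T \<in> tabs. T x = k'} {T \<in> tabs. T x = k}"
      unfolding bij_betw_def inj_on_def image_def
      by (auto simp: set_eq_iff) (metis transpose_involutory transpose_apply_second transpose_apply_first)+
  qed
  have "tabs = (\<Union>k'\<in>{1..n}. {T \<in> tabs. T x = k'})" using tabs_range[OF _ x] by auto
  then have "card tabs = card (\<Union>k'\<in>{1..n}. {T \<in> tabs. T x = k'})" by simp
  also have "\<dots> = (\<Sum>k'\<in>{1..n}. card {T \<in> tabs. T x = k'})"
    using finite_tabs by (intro card_UN_disjoint) auto
  also have "\<dots> = n * card {T \<in> tabs. T x = k}" using same by simp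
  finally have "n * card {T \<in> tabs. T x = k} = n * fact (n - 1)"
    using card_tabs fact_reduce[of n, where 'a = nat] k by simp
  then show ?thesis using k by simp
qed

end

section \<open>Exchange numbers\<close>

text \<open>An entry \<open>v + 1\<close> in the sliding cell reaches the same small entries as an entry \<open>v\<close> would: the slides differ
  only if the slide of \<open>v + 1\<close> ends with an exchange of \<open>v\<close> and \<open>v + 1\<close>.\<close>

lemma (in young) slide_fuel_transpose:
  assumes "hole_incr (R i j) V q" "inj_on V D" "V q = v" "l < v"
  shows "slide_fuel D (\<lambda>u. transpose v (Suc v) (V u)) q f u = l \<longleftrightarrow> slide_fuel D V q f u = l"
  using assms
proof (induction f arbitrary: V q)
  case 0
  then show ?case by (auto simp: transpose_def)
next
  case (Suc f)
  let ?g = "transpose v (Suc v)"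
  let ?gV = "\<lambda>u. ?g (V u)"
  have gl: "?g k = l \<longleftrightarrow> k = l" for k using Suc.prems(4) by (auto simp: transpose_def)
  have qR: "q \<in> R i j" using Suc.prems(1) by (simp add: hole_incr_def)
  then have qD: "q \<in> D" by (rule tailD)
  have nb: "w \<noteq> q" "V w \<noteq> v" if "w \<in> D \<inter> nbrs q" for w
    using that cle_nbrs(2)[of w q] inj_onD[OF Suc.prems(2), of w q] qD Suc.prems(3) by auto
  show ?case
  proof (cases rule: slide_fuel_Suc_cases[of D V q f])
    case (step y)
    note V = step
    have y: "y \<in> D \<inter> nbrs q" "\<And>w. w \<in> D \<inter> nbrs q \<Longrightarrow> V y \<le> V w" "V y < v"
      using step(1) Suc.prems(3) by (auto simp: exch_def)
    have gy: "?gV y = V y" using y(3) by (auto simp: transpose_def)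
    show ?thesis
    proof (cases rule: slide_fuel_Suc_cases[of D ?gV q f])
      case (step y')
      have y': "y' \<in> D \<inter> nbrs q" "?gV y' \<le> ?gV y" using step(1) y(1) unfolding exch_def by blast+
      have "V y' \<le> V y" using y'(2) y(3) gy nb(2)[OF y'(1)] by (auto simp: transpose_def split: if_splits)
      then have "V y' = V y" using y(2)[OF y'(1)] by simp
      then have yy: "y' = y" using inj_onD[OF Suc.prems(2)] y(1) y'(1) by blast
      have sw: "swap_cells ?gV q y = (\<lambda>u. ?g (swap_cells V q y u))" by (auto simp: swap_cells_def fun_eq_iff)
      have "hole_incr (R i j) (swap_cells V q y) y" using exch_hole_incr[OF Suc.prems(1) V(1) Suc.prems(2)] .
      moreover have "inj_on (swap_cells V q y) D" using inj_on_swap_cells[OF Suc.prems(2) qD] y by simp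
      ultimately show ?thesis using Suc.IH[of "swap_cells V q y" y] V(2) step(2) Suc.prems(3,4) yy sw by simp
    next
      case stop
      then show ?thesis using stop(1)[OF y(1)] gy y(3) Suc.prems(3) by simp
    qed
  next
    case stop
    note V = stop
    show ?thesis
    proof (cases rule: slide_fuel_Suc_cases[of D ?gV q f])
      case (step y)
      have y: "y \<in> D \<inter> nbrs q" "?gV y < Suc v" using step(1) Suc.prems(3) by (auto simp: exch_def)
      \<comment> \<open>The slide of \<open>v\<close> stops here while that of \<open>v + 1\<close>
        goes on, so the neighbour holds \<open>v + 1\<close>, relabelled as \<open>v\<close>. The
        cells next to \<open>y\<close> carry larger entries, so the second slide ends after this
        exchange.\<close>
      have Vy: "V y = Suc v" using y V(1)[OF y(1)] Suc.prems(3) nb(2)[OF y(1)]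
        by (auto simp: transpose_def split: if_splits)
      let ?W = "swap_cells ?gV q y"
      have yR: "y \<in> R i j" using tail_up[OF qR] y(1) cle_nbrs(1) by blast
      have W: "?W y = Suc v" using Suc.prems(3) by simp
      have big: "?W y < ?W w" if w: "w \<in> D \<inter> nbrs y" for w
      proof -
        have c: "cle y w" "w \<noteq> y" "w \<noteq> q" using w y(1) cle_nbrs[of w y] cle_nbrs[of y q] by auto
        have "w \<in> R i j" using tail_up[OF yR] w c(1) by blast
        then have "V y < V w" using Suc.prems(1) yR c nb(1)[OF y(1)] by (auto simp: hole_incr_def incr_on_def)
        then show ?thesis using c Vy Suc.prems(3) by (simp add: transpose_def)
      qed
      have "slide_fuel D ?W y f = ?W"
      proof (cases f)
        case (Suc f')
        have "slide_fuel D ?W y (Suc f') = ?W"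
        proof (cases rule: slide_fuel_Suc_cases[of D ?W y f'])
          case (step w)
          then have "w \<in> D \<inter> nbrs y" "?W w < ?W y" unfolding exch_def by blast+
          then show ?thesis using big[of w] by simp
        next
          case stop
          then show ?thesis by simp
        qed
        then show ?thesis using Suc by simp
      qed simp
      moreover have "?W u = l \<longleftrightarrow> V u = l"
        using gl Vy Suc.prems(3,4) by (auto simp: swap_cells_def transpose_def)
      ultimately show ?thesis using V(2) step(2) by simp
    next
      case stop
      then show ?thesis using V(2) gl by simp
    qed
  qed
qed

section \<open>Net exits over the slides of a given value\<close>

context partition_shape begin

definition moved :: "nat \<Rightarrow> cell \<Rightarrow> tabl \<Rightarrow> nat \<Rightarrow> int" where
  "moved l x T m = of_bool (stage T (Suc m) x = l) - of_bool (stage T m x = l)"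

text \<open>The exits of \<open>l\<close> from \<open>x\<close> minus its entries into \<open>x\<close>, over the slides of \<open>v\<close>.\<close>

definition net_exits :: "nat \<Rightarrow> nat \<Rightarrow> cell \<Rightarrow> int" where
  "net_exits v l x = (\<Sum>m\<in>{1..n}. \<Sum>T\<in>{T \<in> tabs. T (cell m) = v}. moved l x T m)"

lemma tabs_ex: "T \<in> tabs \<Longrightarrow> 1 \<le> k \<Longrightarrow> k \<le> n \<Longrightarrow> \<exists>u\<in>D. T u = k"
proof -
  assume "T \<in> tabs" "1 \<le> k" "k \<le> n"
  then have "k \<in> T ` D" by (simp add: tabs_iff)
  then show ?thesis by blast
qed

lemma tabs_inj: "T \<in> tabs \<Longrightarrow> T u = T w \<Longrightarrow> u \<in> D \<Longrightarrow> w \<in> D \<Longrightarrow> u = w"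
  using tabs_iff inj_onD by metis

text \<open>Each slide has exactly one moving value, so summing over \<open>v\<close> removes the
  restriction on \<open>T\<close>; the sum over \<open>m\<close> then telescopes.\<close>

lemma sum_net_exits_slid:
  assumes x: "x \<in> D"
  shows "(\<Sum>v\<in>{1..n}. net_exits v l x) =
    int (card {T \<in> tabs. T x = l}) - int (card {T \<in> tabs. stage T 1 x = l})"
proof -
  have "(\<Sum>v\<in>{1..n}. net_exits v l x) =
    (\<Sum>m\<in>{1..n}. \<Sum>v\<in>{1..n}. \<Sum>T\<in>{T \<in> tabs. T (cell m) = v}. moved l x T m)"
    unfolding net_exits_def by (rule sum.swap)
  also have "\<dots> = (\<Sum>m\<in>{1..n}. \<Sum>T\<in>tabs. moved l x T m)"
  proof (rule sum.cong[OF HOL.refl])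
    fix m assume "m \<in> {1..n}"
    then show "(\<Sum>v\<in>{1..n}. \<Sum>T\<in>{T \<in> tabs. T (cell m) = v}. moved l x T m) = (\<Sum>T\<in>tabs. moved l x T m)"
      using tabs_range[OF _ cellD[of m]] finite_tabs by (intro sum.group) auto
  qed
  also have "\<dots> = (\<Sum>T\<in>tabs. \<Sum>m\<in>{1..n}. moved l x T m)" by (rule sum.swap)
  also have "\<dots> = (\<Sum>T\<in>tabs. of_bool (T x = l) - of_bool (stage T 1 x = l))"
    unfolding moved_def by (intro sum.cong HOL.refl, subst sum_Suc_diff) (auto simp: stage_Suc_n)
  also have "\<dots> = int (card {T \<in> tabs. T x = l}) - int (card {T \<in> tabs. stage T 1 x = l})"
    using finite_tabs by (simp add: sum_subtractf sum.If_cases of_bool_def Int_def)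
  finally show ?thesis .
qed

lemma sum_of_bool_entry:
  assumes "V \<in> tabs" "x \<in> D"
  shows "(\<Sum>l\<in>{1..n}. of_bool (V x = l)) = (1 :: int)"
  using tabs_range[OF assms] by (simp add: of_bool_def)

lemma sum_net_exits_entry:
  assumes x: "x \<in> D"
  shows "(\<Sum>l\<in>{1..n}. net_exits v l x) = 0"
proof -
  have "(\<Sum>l\<in>{1..n}. net_exits v l x) =
    (\<Sum>m\<in>{1..n}. \<Sum>T\<in>{T \<in> tabs. T (cell m) = v}. \<Sum>l\<in>{1..n}. moved l x T m)"
    unfolding net_exits_def by (subst sum.swap) (intro sum.cong HOL.refl sum.swap)
  also have "\<dots> = 0"
  proof (rule sum.neutral, rule ballI, rule sum.neutral, rule ballI)
    fix m T assume "m \<in> {1..n}" "T \<in> {T \<in> tabs. T (cell m) = v}"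
    then have "stage T m \<in> tabs" "stage T (Suc m) \<in> tabs" using stage_tabs by auto
    then show "(\<Sum>l\<in>{1..n}. moved l x T m) = 0"
      unfolding moved_def sum_subtractf using sum_of_bool_entry x by simp
  qed
  finally show ?thesis .
qed

text \<open>A slide exchanges its entry with smaller ones only, so \<open>l > v\<close> stays in
  place.\<close>

lemma net_exits_large:
  assumes x: "x \<in> D" and l: "v < l" "l \<le> n"
  shows "net_exits v l x = 0"
proof -
  have "moved l x T m = 0" if m: "m \<in> {1..n}" and T: "T \<in> tabs" "T (cell m) = v" for m T
  proof -
    let ?V = "stage T (Suc m)" and ?W = "stage T m"
    have VW: "?V \<in> tabs" "?W \<in> tabs" using stage_tabs[OF T(1)] m by auto
    have "?V (cell m) = v" using stage_unprocessed[of m "Suc m" T] m T by simp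
    moreover have "?W = slide_fuel D ?V (cell m) n" using stage_step[of m T] m by (simp add: slide_def size)
    ultimately have keep: "?W u = ?V u" if "v < ?V u" for u using slide_fuel_large[of ?V "cell m" u D n] that by simp
    obtain u where u: "u \<in> D" "?V u = l" using tabs_ex[OF VW(1), of l] l by (auto simp del: split_paired_Ex)
    then have "?W u = l" using keep[of u] l by simp
    then have "?V x = l \<longleftrightarrow> ?W x = l" using tabs_inj[OF VW(1) _ u(1) x] tabs_inj[OF VW(2) _ u(1) x] u(2) by metis
    then show ?thesis by (simp add: moved_def)
  qed
  then show ?thesis by (auto simp: net_exits_def)
qed

text \<open>One of \<open>v\<close> and \<open>v + 1\<close> rests in \<open>cell m\<close> until
  its turn and is invisible to the slides at later cells. On the entries that these compare, the
  transposition is therefore strictly monotone.\<close>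

lemma stage_transpose:
  assumes T: "T \<in> tabs" and m: "1 \<le> m" "m \<le> n" and Tm: "T (cell m) \<in> {v, Suc v}" and m': "m < m'" "m' \<le> Suc n"
  shows "stage (\<lambda>u. transpose v (Suc v) (T u)) m' = (\<lambda>u. transpose v (Suc v) (stage T m' u))"
  using m'(2,1)
proof (induction m' rule: inc_induct)
  case base
  then show ?case by (simp add: stage_Suc_n)
next
  case (step k)
  let ?g = "transpose v (Suc v)" and ?V = "stage T (Suc k)"
  have k: "1 \<le> k" "k \<le> n" "m < k" using step m by auto
  have V: "?V \<in> tabs" using stage_tabs[OF T, of "Suc k"] k by auto
  have Vm: "?V (cell m) = T (cell m)" using stage_unprocessed[of m "Suc k" T] m k by simp
  have ne: "?V u \<noteq> T (cell m)" if "u \<in> D" "cle (cell k) u" for u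
  proof
    assume "?V u = T (cell m)"
    then have "u = cell m" using tabs_inj[OF V _ that(1) cellD[OF m]] Vm by simp
    then show False using that cell_less[of m k] m k by (auto simp: cle_def)
  qed
  have "strict_mono_on (?V ` {u \<in> D. cle (cell k) u}) ?g"
  proof (rule strict_mono_onI)
    fix a b assume ab: "a \<in> ?V ` {u \<in> D. cle (cell k) u}" "b \<in> ?V ` {u \<in> D. cle (cell k) u}" "a < b"
    have "c \<noteq> T (cell m)" if "c \<in> ?V ` {u \<in> D. cle (cell k) u}" for c
      using that by (rule imageE) (use ne in simp)
    then have "a \<noteq> T (cell m)" "b \<noteq> T (cell m)" using ab by simp_all
    then show "?g a < ?g b" using Tm ab(3) by (auto simp: transpose_def)
  qed
  from slide_fuel_comp[OF cellD[OF k(1,2)] this, of n]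
  show ?case using step stage_step[OF k(1,2)] k by (simp add: slide_def size)
qed

text \<open>The transposition pairs the tabloids with \<open>v\<close> and with \<open>v + 1\<close>
  in \<open>cell m\<close>. It commutes with the slides before that cell by
  \<open>stage_transpose\<close>, and \<open>slide_fuel_transpose\<close> covers the slide at the
  cell itself.\<close>

lemma net_exits_Suc:
  assumes v: "1 \<le> v" "v < n" and l: "l < v"
  shows "net_exits (Suc v) l x = net_exits v l x"
  unfolding net_exits_def
proof (rule sum.cong[OF HOL.refl])
  fix m assume "m \<in> {1..n}"
  then have m: "1 \<le> m" "m \<le> n" by auto
  let ?g = "transpose v (Suc v)"
  let ?t = "\<lambda>T u. ?g (T u)"
  have gt: "?t T \<in> tabs" if "T \<in> tabs" for T
    using permutes_tabs[of ?g] permutes_swap_id[of v "{1..n}" "Suc v"] v that bij_betwE by fastforce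
  have "moved l x (?t T) m = moved l x T m" if T: "T \<in> tabs" "T (cell m) = v" for T
  proof -
    let ?V = "stage T (Suc m)"
    obtain i j where ij: "cell m = (i, j)" by (cases "cell m")
    have V: "?V \<in> tabs" using stage_tabs[OF T(1), of "Suc m"] m by auto
    have Vm: "?V (cell m) = v" using stage_unprocessed[of m "Suc m" T] m T by simp
    have st: "stage (?t T) (Suc m) = ?t ?V" using stage_transpose[OF T(1) m, of v "Suc m"] T(2) m by simp
    have "incr_on (R (Suc i) j) ?V" using stage_incr[OF T(1), of "Suc m"] cell_tail(2)[OF m ij] m by simp
    then have "hole_incr (R i j) ?V (cell m)" using hole_incr_start cellD[OF m] ij by simp
    from slide_fuel_transpose[OF this _ Vm l, of n]
    have "slide lam (?t ?V) (cell m) x = l \<longleftrightarrow> slide lam ?V (cell m) x = l"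
      using V by (simp add: slide_def size tabs_iff)
    then have "stage (?t T) m x = l \<longleftrightarrow> stage T m x = l" using stage_step[OF m] st by simp
    moreover have "?t ?V x = l \<longleftrightarrow> ?V x = l" using l by (auto simp: transpose_def)
    ultimately show ?thesis using st by (simp add: moved_def)
  qed
  note mv = this
  show "(\<Sum>T\<in>{T \<in> tabs. T (cell m) = Suc v}. moved l x T m) = (\<Sum>T\<in>{T \<in> tabs. T (cell m) = v}. moved l x T m)"
  proof (rule sum.reindex_bij_witness[of _ ?t ?t])
    fix T assume T: "T \<in> {T \<in> tabs. T (cell m) = Suc v}"
    then have tT: "?t T \<in> tabs" "?t T (cell m) = v" using gt by auto
    then show "?t T \<in> {T \<in> tabs. T (cell m) = v}" by simp
    show "?t (?t T) = T" by simp
    show "moved l x (?t T) m = moved l x T m" using mv[OF tT] by simp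
  qed (use gt in auto)
qed

lemma net_exits_const:
  assumes "1 \<le> v" "v \<le> n" "l < v"
  shows "net_exits v l x = net_exits n l x"
  using assms(2,1,3)
proof (induction v rule: inc_induct)
  case (step v)
  then show ?case using net_exits_Suc[of v l x] by simp
qed simp

lemma N_minus_iff: "x \<in> D \<Longrightarrow> y \<in> N_minus lam x \<longleftrightarrow> y \<in> D \<and> x \<in> nbrs y"
  using pos[of "fst x" "snd x"] pos[of "fst y" "snd y"]
  by (cases x; cases y) (auto simp: N_minus_def nbrs_def)

lemma N_plus_eq: "N_plus lam x = nbrs x \<inter> D"
  by (auto simp: N_plus_def nbrs_def)

text \<open>By \<open>slide_fuel_local\<close>, \<open>k\<close> stays in its cell \<open>p\<close>
  or moves to a cell \<open>q\<close> of which \<open>p\<close> is a right or bottom neighbour. So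
  at most one summand of each sum is nonzero.\<close>

lemma moved_eq_exchanges:
  assumes T: "T \<in> tabs" and m: "1 \<le> m" "m \<le> n" "T (cell m) = n" and k: "1 \<le> k" "k < n" and x: "x \<in> D"
  shows "moved k x T m =
    (\<Sum>y\<in>N_minus lam x. of_bool (stage T (Suc m) x = k \<and> stage T m y = k)) -
    (\<Sum>y\<in>N_plus lam x. of_bool (stage T (Suc m) y = k \<and> stage T m x = k))"
proof -
  let ?V = "stage T (Suc m)" and ?W = "stage T m"
  have VW: "?V \<in> tabs" "?W \<in> tabs" using stage_tabs[OF T] m by auto
  have Vm: "?V (cell m) = n" using stage_unprocessed[of m "Suc m" T] m by simp
  obtain p where p: "p \<in> D" "?V p = k" using tabs_ex[OF VW(1), of k] k by (auto simp del: split_paired_Ex)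
  obtain q where q: "q \<in> D" "?W q = k" using tabs_ex[OF VW(2), of k] k by (auto simp del: split_paired_Ex)
  have Vp: "?V u = k \<longleftrightarrow> u = p" if "u \<in> D" for u using tabs_inj[OF VW(1) _ that p(1)] p(2) by auto
  have Wq: "?W u = k \<longleftrightarrow> u = q" if "u \<in> D" for u using tabs_inj[OF VW(2) _ that q(1)] q(2) by auto
  have "?W q \<in> {?V q, ?V (cell m)} \<union> ?V ` (D \<inter> nbrs q)"
    using slide_fuel_local[of D ?V "cell m" n q] stage_step[of m T] m by (simp add: slide_def size)
  then consider "?V q = k" | u where "u \<in> D" "u \<in> nbrs q" "?V u = k" using q(2) Vm k by auto
  then have pq: "p = q \<or> p \<in> nbrs q" using Vp q(1) by cases auto
  have fin': "finite (N_minus lam x)" "finite (N_plus lam x)" by (auto simp: N_minus_def N_plus_def)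
  have "(\<Sum>y\<in>N_minus lam x. of_bool (?V x = k \<and> ?W y = k)) = (\<Sum>y\<in>N_minus lam x. if y = q then of_bool (x = p) else (0::int))"
    using Vp[OF x] Wq N_minus_iff[OF x] by (intro sum.cong) auto
  also have "\<dots> = of_bool (x = p \<and> p \<in> nbrs q)"
    using fin' N_minus_iff[OF x, of q] q(1) by auto
  finally have 1: "(\<Sum>y\<in>N_minus lam x. of_bool (?V x = k \<and> ?W y = k)) = (of_bool (x = p \<and> p \<in> nbrs q) :: int)" .
  have "(\<Sum>y\<in>N_plus lam x. of_bool (?V y = k \<and> ?W x = k)) = (\<Sum>y\<in>N_plus lam x. if y = p then of_bool (x = q) else (0::int))"
    using Vp Wq[OF x] N_plus_eq by (intro sum.cong) auto
  also have "\<dots> = of_bool (x = q \<and> p \<in> nbrs q)"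
    using fin' N_plus_eq p(1) by auto
  finally have 2: "(\<Sum>y\<in>N_plus lam x. of_bool (?V y = k \<and> ?W x = k)) = (of_bool (x = q \<and> p \<in> nbrs q) :: int)" .
  have "moved k x T m = of_bool (x = p) - of_bool (x = q)" by (simp add: moved_def Vp[OF x] Wq[OF x])
  then show ?thesis unfolding 1 2 using pq cle_nbrs(2)[of q q] by auto
qed

text \<open>The entry \<open>n\<close> lies in one cell only, so the index \<open>m\<close> in the
  definition of \<open>eps\<close> is unique and the count splits into a sum. The added index
  \<open>m = n\<close> gives nothing, as the slide there is trivial and
  \<open>x \<noteq> y\<close>.\<close>

lemma eps_sum:
  assumes "1 \<le> n" "x \<in> D" "y \<in> D" "x \<noteq> y" "1 \<le> k"
  shows "int (eps lam k x y) = (\<Sum>m\<in>{1..n}. \<Sum>T\<in>{T \<in> tabs. T (cell m) = n}.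
    of_bool (stage T (Suc m) x = k \<and> stage T m y = k))"
proof -
  let ?A = "\<lambda>m. {T \<in> {T \<in> tabs. T (cell m) = n}. stage T (Suc m) x = k \<and> stage T m y = k}"
  have last: "?A n = {}"
  proof -
    have "stage T (Suc n) = stage T n" for T using stage_step[of n T] slide_last assms by simp
    then have "x = y" if "T \<in> ?A n" for T
      using that tabs_inj[OF stage_tabs[of T n], of x y] assms by simp
    then show ?thesis using assms(4) by blast
  qed
  have "{T \<in> tabs. \<exists>m. 1 \<le> m \<and> m < n \<and> T (cell m) = n \<and> stage T (Suc m) x = k \<and> stage T m y = k} =
    (\<Union>m\<in>{1..n}. ?A m)"
  proof (intro equalityI subsetI)
    fix T assume "T \<in> (\<Union>m\<in>{1..n}. ?A m)"
    then obtain m where "m \<in> {1..n}" "T \<in> ?A m" by blast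
    moreover have "m \<noteq> n" using last calculation(2) by (metis empty_iff)
    ultimately show "T \<in> {T \<in> tabs. \<exists>m. 1 \<le> m \<and> m < n \<and> T (cell m) = n \<and> stage T (Suc m) x = k \<and> stage T m y = k}"
      by auto
  qed auto
  then have "eps lam k x y = card (\<Union>m\<in>{1..n}. ?A m)" by (simp add: eps_def size)
  also have "\<dots> = (\<Sum>m\<in>{1..n}. card (?A m))"
  proof (rule card_UN_disjoint)
    show "\<forall>i\<in>{1..n}. \<forall>j\<in>{1..n}. i \<noteq> j \<longrightarrow> ?A i \<inter> ?A j = {}"
    proof (intro ballI impI)
      fix i j assume ij: "i \<in> {1..n}" "j \<in> {1..n}" "i \<noteq> j"
      then have c: "cell i \<noteq> cell j" using inj_onD[OF bij_betw_imp_inj_on[OF cell_bij], of i j] by blast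
      have "cell i = cell j" if "T \<in> tabs" "T (cell i) = n" "T (cell j) = n" for T
        using tabs_inj[OF that(1), of "cell i" "cell j"] that cellD[of i] cellD[of j] ij by simp
      then show "?A i \<inter> ?A j = {}" using c by blast
    qed
  qed (use finite_tabs in auto)
  finally show ?thesis using finite_tabs by (simp add: of_bool_def sum.If_cases Int_def)
qed

lemma Delta_eq_net_exits:
  assumes k: "1 \<le> k" "k < n" and x: "x \<in> D"
  shows "Delta lam k x = net_exits n k x"
proof -
  let ?A = "\<lambda>m. {T \<in> tabs. T (cell m) = n}"
  have e1: "int (eps lam k x y) = (\<Sum>m\<in>{1..n}. \<Sum>T\<in>?A m. of_bool (stage T (Suc m) x = k \<and> stage T m y = k))"
    if "y \<in> N_minus lam x" for y
    using that N_minus_iff[OF x, of y] cle_nbrs(2)[of x y] k x by (intro eps_sum) auto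
  have e2: "int (eps lam k y x) = (\<Sum>m\<in>{1..n}. \<Sum>T\<in>?A m. of_bool (stage T (Suc m) y = k \<and> stage T m x = k))"
    if "y \<in> N_plus lam x" for y
    using that N_plus_eq[of x] cle_nbrs(2)[of y x] k x by (intro eps_sum) auto
  have "Delta lam k x =
    (\<Sum>m\<in>{1..n}. \<Sum>T\<in>?A m. \<Sum>y\<in>N_minus lam x. of_bool (stage T (Suc m) x = k \<and> stage T m y = k)) -
    (\<Sum>m\<in>{1..n}. \<Sum>T\<in>?A m. \<Sum>y\<in>N_plus lam x. of_bool (stage T (Suc m) y = k \<and> stage T m x = k))"
    unfolding Delta_def
    by (simp only: e1 e2 sum.swap[of _ _ "N_minus lam x"] sum.swap[of _ _ "N_plus lam x"] cong: sum.cong)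
  also have "\<dots> = net_exits n k x"
    unfolding net_exits_def sum_subtractf[symmetric]
    using moved_eq_exchanges k x by (intro sum.cong HOL.refl) auto
  finally show ?thesis .
qed

lemma Delta_recursion:
  assumes k: "1 \<le> k" "k < n" and x: "x \<in> D"
  shows "real (n - k) * real_of_int (Delta lam k x) =
    fact (n - 1) - fact n * real (f_lam_at lam k x) / real (f_lam lam)
    + (\<Sum>l = 1..k - 1. real_of_int (Delta lam l x))"
proof -
  obtain C where C: "\<And>P. card {T \<in> tabs. P (stage T 1)} = C * card {S. standard lam S \<and> P S}"
    using card_sorted[of thesis] k by auto
  \<comment> \<open>Imposing no condition on the sorted tableau determines \<open>C\<close> as
    \<open>n!\<close> divided by the number of standard tableaux.\<close>
  have total: "fact n = C * f_lam lam" using C[of "\<lambda>_. True"] card_tabs by (simp add: f_lam_def)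
  have "(\<Sum>v\<in>{1..n}. net_exits v k x) = fact (n - 1) - int (C * f_lam_at lam k x)"
    using sum_net_exits_slid[OF x, of k] C[of "\<lambda>S. S x = k"] card_tabs_at[OF x k(1)] k by (simp add: f_lam_at_def)
  moreover have split: "sum f {1..n} = sum f {1..<k} + f k + sum f {k<..n}" for f :: "nat \<Rightarrow> int"
  proof -
    have "{1..n} = {1..<k} \<union> insert k {k<..n}" using k by auto
    moreover have "sum f ({1..<k} \<union> insert k {k<..n}) = sum f {1..<k} + sum f (insert k {k<..n})"
      by (rule sum.union_disjoint) auto
    moreover have "sum f (insert k {k<..n}) = f k + sum f {k<..n}" by (rule sum.insert) auto
    ultimately show ?thesis by (metis add.assoc)
  qed
  moreover have "(\<Sum>v\<in>{1..<k}. net_exits v k x) = 0"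
    using net_exits_large[OF x, of _ k] k by (intro sum.neutral) auto
  moreover have "(\<Sum>v\<in>{k<..n}. net_exits v k x) = (\<Sum>v\<in>{k<..n}. Delta lam k x)"
  proof (rule sum.cong[OF HOL.refl])
    fix v assume "v \<in> {k<..n}"
    then show "net_exits v k x = Delta lam k x"
      using net_exits_const[of v k x] Delta_eq_net_exits[OF k x] k by simp
  qed
  moreover have "net_exits k k x = - (\<Sum>l\<in>{1..<k}. Delta lam l x)"
  proof -
    have "0 = (\<Sum>l\<in>{1..<k}. net_exits k l x) + net_exits k k x + (\<Sum>l\<in>{k<..n}. net_exits k l x)"
      using sum_net_exits_entry[OF x, of k] split[of "\<lambda>l. net_exits k l x"] by simp
    moreover have "(\<Sum>l\<in>{k<..n}. net_exits k l x) = 0"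
      using net_exits_large[OF x, of k] by (intro sum.neutral) auto
    moreover have "(\<Sum>l\<in>{1..<k}. net_exits k l x) = (\<Sum>l\<in>{1..<k}. Delta lam l x)"
    proof (rule sum.cong[OF HOL.refl])
      fix l assume "l \<in> {1..<k}"
      then show "net_exits k l x = Delta lam l x"
        using net_exits_const[of k l x] Delta_eq_net_exits[OF _ _ x, of l] k by simp
    qed
    ultimately show ?thesis by simp
  qed
  ultimately have "int (n - k) * Delta lam k x = fact (n - 1) - int (C * f_lam_at lam k x) + (\<Sum>l\<in>{1..<k}. Delta lam l x)"
    using split[of "\<lambda>v. net_exits v k x"] by simp
  then have "real_of_int (int (n - k) * Delta lam k x) =
      real_of_int (fact (n - 1) - int (C * f_lam_at lam k x) + (\<Sum>l\<in>{1..<k}. Delta lam l x))" by simp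
  then have main: "real (n - k) * real_of_int (Delta lam k x) =
    fact (n - 1) - real C * real (f_lam_at lam k x) + (\<Sum>l\<in>{1..<k}. real_of_int (Delta lam l x))"
    by simp
  have "fact n = real C * real (f_lam lam)" using total by (metis of_nat_fact of_nat_mult)
  moreover have "f_lam lam \<noteq> 0" using total by (metis fact_nonzero mult_0_right)
  ultimately have "fact n * real (f_lam_at lam k x) / real (f_lam lam) = real C * real (f_lam_at lam k x)" by simp
  moreover have "{1..k - 1} = {1..<k}" using k by auto
  ultimately show ?thesis using main by simp
qed

end

section \<open>Solving the recursion\<close>

lemma closed_form_of_recursion:
  fixes \<delta> a :: "nat \<Rightarrow> real"
  assumes rec: "\<And>k. 1 \<le> k \<Longrightarrow> k < n \<Longrightarrow>
      real (n - k) * \<delta> k = fact (n - 1) - fact n * a k + (\<Sum>l = 1..k - 1. \<delta> l)"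
    and k: "1 \<le> k" "k < n"
  shows "\<delta> k = fact n / (real (n - k) * real (n - k + 1)) *
    (1 - a k * real (n - k + 1) - (\<Sum>l = 1..k - 1. a l))"
proof -
  \<comment> \<open>In terms of partial sums the recursion telescopes: its last term adds one more
    copy of the previous sum to the \<open>n - m - 1\<close> copies already there.\<close>
  have partial: "real (n - m) * (\<Sum>l = 1..m. \<delta> l) = real m * fact (n - 1) - fact n * (\<Sum>l = 1..m. a l)" if "m < n" for m
    using that
  proof (induction m)
    case (Suc m)
    have "real (n - Suc m) * (\<Sum>l = 1..Suc m. \<delta> l) = real (n - Suc m) * (\<Sum>l = 1..m. \<delta> l) + real (n - Suc m) * \<delta> (Suc m)"
      by (simp add: algebra_simps)
    also have "real (n - Suc m) * \<delta> (Suc m) = fact (n - 1) - fact n * a (Suc m) + (\<Sum>l = 1..m. \<delta> l)"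
      using rec[of "Suc m"] Suc.prems by simp
    also have "real (n - Suc m) * (\<Sum>l = 1..m. \<delta> l) + (fact (n - 1) - fact n * a (Suc m) + (\<Sum>l = 1..m. \<delta> l)) =
       real (n - m) * (\<Sum>l = 1..m. \<delta> l) + fact (n - 1) - fact n * a (Suc m)"
      using Suc.prems by (simp add: of_nat_diff algebra_simps)
    finally show ?case using Suc by (simp add: algebra_simps)
  qed simp
  define s where "s = (\<Sum>l = 1..k - 1. \<delta> l)"
  define b where "b = (\<Sum>l = 1..k - 1. a l)"
  define d where "d = real (n - k)"
  have d: "0 < d" "real (n - k + 1) = d + 1" "real (n - (k - 1)) = d + 1" using k by (auto simp: d_def of_nat_diff)
  have kn: "real (k - 1) = real n - d - 1" using k by (auto simp: d_def of_nat_diff)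
  have fn: "fact n = real n * fact (n - 1)" using fact_reduce[of n] k by simp
  have 1: "(d + 1) * s = (real n - d - 1) * fact (n - 1) - fact n * b"
    using partial[of "k - 1"] k unfolding d(3) kn by (simp add: s_def b_def)
  have 2: "d * \<delta> k = fact (n - 1) - fact n * a k + s" using rec[OF k] by (simp add: d_def s_def)
  have "d * (d + 1) * \<delta> k = (d + 1) * (d * \<delta> k)" by simp
  also have "\<dots> = (d + 1) * fact (n - 1) - (d + 1) * (fact n * a k) + (d + 1) * s"
    unfolding 2 by (simp add: algebra_simps)
  \<comment> \<open>The multiples \<open>d + 1\<close> and \<open>real n - d - 1\<close> of
    \<open>fact (n - 1)\<close> add up to \<open>fact n\<close>.\<close>
  also have "\<dots> = fact n * (1 - a k * (d + 1) - b)" unfolding 1 fn by (simp add: algebra_simps)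
  finally have "\<delta> k = fact n * (1 - a k * (d + 1) - b) / (d * (d + 1))"
    using d(1) by (simp add: eq_divide_eq mult.commute)
  then show ?thesis unfolding d(2) by (simp add: d_def b_def)
qed

theorem theorem2:
  fixes k n :: nat and lam :: "nat list" and x :: cell
  assumes "1 \<le> k" and "k < n" and "is_partition lam n" and "x \<in> diagram lam"
  shows "real (n - k) * real_of_int (Delta lam k x) =
           fact (n - 1) - fact n * real (f_lam_at lam k x) / real (f_lam lam)
           + (\<Sum>l = 1..k - 1. real_of_int (Delta lam l x))
     \<and> real_of_int (Delta lam k x) =
           fact n / (real (n - k) * real (n - k + 1)) *
           (1 - real (f_lam_at lam k x) / real (f_lam lam) * real (n - k + 1)
              - (\<Sum>l = 1..k - 1. real (f_lam_at lam l x) / real (f_lam lam)))"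
proof -
  interpret partition_shape lam n using assms(3) by unfold_locales
  note rec = Delta_recursion[OF _ _ assms(4)]
  show ?thesis
    using rec[OF assms(1,2)] rec assms(1,2)
    by (intro conjI closed_form_of_recursion[where \<delta> = "\<lambda>k. real_of_int (Delta lam k x)" and
        a = "\<lambda>k. real (f_lam_at lam k x) / real (f_lam lam)"]) auto
qed

end
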